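(* Consider $N$ agents with local cost functions $f_{i,t}$ and communication graph $\mathcal{G}$ as in the context, $f_t(x)=\sum_{i=1}^N f_{i,t}(x)$ for $x\in\mathbb{R}^n$, and $F_t(\mathbf{x})=\sum_{i=1}^N f_{i,t}(\mathbf{x}_i)$ for $\mathbf{x}=[\mathbf{x}_1^T,\dots,\mathbf{x}_N^T]^T\in\mathbb{R}^{Nn}$. Assume: (B1) for every $t\ge T_0$ a minimizer $x_t^*$ of $f_t$ over $\mathbb{R}^n$ exists and $\|x_t^*\|\le c_0'$ for a constant $c_0'>0$ independent of $t$; (B2) for every $T>T_0$ a minimizer $\tilde x(T)\in\operatorname{argmin}_{x\in\mathbb{R}^n}\int_{T_0}^T f_t(x)\,dt$ exists and is bounded by a constant independent of $T$; (B3) for every $i$ and $t\ge T_0$ a minimizer $\mathbf{x}_i^\dagger(t)$ of $f_{i,t}$ over $\mathbb{R}^n$ exists and $\|\mathbf{x}_i^\dagger(t)\|\le c^\dagger$ for a constant $c^\dagger>0$ independent of $t$; (B4) for every $R>0$ there is $M_R>0$ such that $|f_{i,t}(x)|\le M_R$ for all $\|x\|\le R$, all $t\ge T_0$ and all $i$; (B5) the partial derivative $\nabla_t F_t(\mathbf{x})$ with respect to $t$ is bounded uniformly in $t\ge T_0$ and $\mathbf{x}\in\mathbb{R}^{Nn}$; (B6) there is a constant $m_0$ such that for all $a_1,b_1>0$ there are $a_2,b_2>0$ with the property that, for every function $x(\cdot)$ with $\|x(t)\|\le a_1\sqrt{t}+b_1$ for all $t>T_0$, one has $\|\nabla f_{i,t}(x(t))\|\le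 a_2t^{m_0}+b_2$ for all $t>T_0$ and all $i$. Let $k_1>0$, $\sigma>0$, $m<-1$ with $m\le-2m_0$, and $b_0\ge 1$ with $b_0>(\frac{-m}{\sigma})^{\frac{1}{1-m}}$, and define $\alpha_t,\beta_t$ for $t\ge T_0$ by $$e^{\beta_t}=(t+b_0)^m,\qquad e^{\alpha_t}=m(t+b_0)^{-1}+\sigma(t+b_0)^{-m}>0,$$ so that $e^{\alpha_t+\beta_t}-\dot\beta_te^{\beta_t}=\sigma$. Let $\mathbf{x}_1,\dots,\mathbf{x}_N:[T_0,\infty)\to\mathbb{R}^n$ solve, for $i=1,\dots,N$, $$\ddot{\mathbf{x}}_i+(2e^{\alpha_t}-\dot\alpha_t)\dot{\mathbf{x}}_i+e^{2\alpha_t+\beta_t}\nabla f_{i,t}(\mathbf{x}_i)+\sum_{j=1}^N a_{ij}k_1e^{2\alpha_t}(\mathbf{x}_i-\mathbf{x}_j)=0.$$ Then there exist positive constants $\varrho,\varpi$ independent of $T$, and positive constants $a_2,b_2$ as provided by (B6) with $\|\nabla f_{i,t}(\mathbf{x}_i(t))\|\le a_2t^{m_0}+b_2$ for all $i$ and $t>T_0$, such that for all $T>T_0$: $F_t(\mathbf{y})-F_t(1_N\otimes\tilde x(T))\ge-\varrho$ for all $\mathbf{y}\in\mathbb{R}^{Nn}$ and $t\in[T_0,T]$; $\int_{T_0}^T\bigl(e^{\alpha_t}\mathbf{x}^T(t)\tilde L\mathbf{x}(t)-\frac{\sigma\varrho}{k_1}\bigr)dt\le\frac{\varpi}{k_1}$;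 and $$\mathcal{R}_{s,dis}(T)\le\frac{\varpi}{\sigma}+\frac{Na_2}{\sqrt{\sigma}}\sqrt{\frac{N}{w_{\min}}\epsilon_1(T)}+Nb_2\sqrt{\frac{N}{w_{\min}}\epsilon_2(T)},$$ where $$\epsilon_1(T)=\frac{\sigma\varrho}{k_1}(T-T_0)+\frac{\varpi}{k_1},\qquad \epsilon_2(T)=\frac{\varrho}{k_1b_0^{-m}}(T-T_0)+\frac{\varpi}{k_1\sigma b_0^{-m}}.$$
   Context: $T_0\ge0$ is the initial time. Each local cost $(t,x)\mapsto f_{i,t}(x)\in\mathbb{R}$, $t\ge T_0$, $x\in\mathbb{R}^n$, $i=1,\dots,N$, is continuously differentiable, convex in $x$ for every $t$, and smooth in $t$; for every $t$, $f_t$ and each $f_{i,t}$ have at least one minimizer. $\nabla$ is the gradient in the space variable, $\nabla_t$ the partial derivative in $t$, dots are time derivatives, and $\|\cdot\|$ is the Euclidean norm. $\mathcal{G}$ is an undirected connected graph on $\{1,\dots,N\}$ with symmetric adjacency matrix $[a_{ij}]$, $a_{ij}>0$ if $(j,i)$ is an edge, $a_{ij}=0$ otherwise, $a_{ii}=0$; $w_{\min}>0$ is the minimal (positive) edge weight. $L=D-A$ is its Laplacian with $D=\mathrm{diag}\{\sum_j a_{ij}\}$, and $\tilde L=L\otimes I_n$. $1_N$ is the all-ones column vector, and $\mathbf{x}(t)=[\mathbf{x}_1(t)^T,\dots,\mathbf{x}_N(t)^T]^T$. The distributed static regret is $$\mathcal{R}_{s,dis}(T)=\int_{T_0}^T\Bigl(\frac1N\sum_{j=1}^N\sum_{i=1}^N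 f_{i,t}(\mathbf{x}_j(t))-F_t(1_N\otimes\tilde x(T))\Bigr)dt .$$ *)

theory Defs
  imports "HOL-Analysis.Analysis"
begin

text \<open>
  Agents are indexed by a finite type \<open>'N\<close> (so \<open>N = CARD('N)\<close>), and the decision space is
  \<open>real ^ 'n\<close>.  The stacked space of dimension \<open>N n\<close> is \<open>real ^ ('N \<times> 'n)\<close>; entry \<open>(i, k)\<close>
  is coordinate \<open>k\<close> of agent \<open>i\<close>.  Time derivatives are taken within \<open>{T0..}\<close>, hence are
  one-sided at \<open>T0\<close>; nothing is required of the data before \<open>T0\<close>.
\<close>

definition stack :: "('N::finite \<Rightarrow> real ^ 'n) \<Rightarrow> real ^ ('N \<times> 'n)" where
  "stack x = (\<chi> p. x (fst p) $ snd p)"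

definition block :: "real ^ ('N::finite \<times> 'n) \<Rightarrow> 'N \<Rightarrow> real ^ 'n" where
  "block y i = (\<chi> k. y $ (i, k))"

definition kron :: "real ^ 'a ^ 'b \<Rightarrow> real ^ 'c ^ 'd \<Rightarrow> real ^ ('a \<times> 'c) ^ ('b \<times> 'd)" where
  "kron A B = (\<chi> p q. A $ fst p $ fst q * B $ snd p $ snd q)"

definition kron_vec :: "real ^ 'a \<Rightarrow> real ^ 'b \<Rightarrow> real ^ ('a \<times> 'b)" where
  "kron_vec u v = (\<chi> p. u $ fst p * v $ snd p)"


definition connected_weighted_graph :: "('N \<times> 'N) set \<Rightarrow> real ^ 'N ^ 'N \<Rightarrow> bool" where
  "connected_weighted_graph E A \<longleftrightarrow>
     sym E \<and> irrefl E \<and> (\<forall>i j. (i, j) \<in> E\<^sup>*) \<and>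
     transpose A = A \<and>
     (\<forall>i j. (j, i) \<in> E \<longrightarrow> A $ i $ j > 0) \<and>
     (\<forall>i j. (j, i) \<notin> E \<longrightarrow> A $ i $ j = 0)"

text \<open>If there is no edge at all (a single agent), any positive number is admitted.\<close>

definition minimal_edge_weight :: "('N \<times> 'N) set \<Rightarrow> real ^ 'N ^ 'N \<Rightarrow> real \<Rightarrow> bool" where
  "minimal_edge_weight E A w \<longleftrightarrow>
     w > 0 \<and> (E \<noteq> {} \<longrightarrow> w = Min ((\<lambda>(j, i). A $ i $ j) ` E))"

definition degree_matrix :: "real ^ 'N ^ 'N \<Rightarrow> real ^ 'N ^ 'N" where
  "degree_matrix A = (\<chi> i j. if i = j then (\<Sum>k\<in>UNIV. A $ i $ k) else 0)"

definition laplacian :: "real ^ 'N ^ 'N \<Rightarrow> real ^ 'N ^ 'N" where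
  "laplacian A = degree_matrix A - A"


definition gradient :: "('a::real_inner \<Rightarrow> real) \<Rightarrow> 'a \<Rightarrow> 'a" where
  "gradient g x = (THE D. GDERIV g x :> D)"

definition C1_on :: "'a::real_normed_vector set \<Rightarrow> ('a \<Rightarrow> real) \<Rightarrow> bool" where
  "C1_on S g \<longleftrightarrow>
     (\<exists>D :: 'a \<Rightarrow> 'a \<Rightarrow>\<^sub>L real.
        (\<forall>p\<in>S. (g has_derivative blinfun_apply (D p)) (at p within S)) \<and> continuous_on S D)"

definition smooth_on :: "real set \<Rightarrow> (real \<Rightarrow> real) \<Rightarrow> bool" where
  "smooth_on S g \<longleftrightarrow>
     (\<exists>D :: nat \<Rightarrow> real \<Rightarrow> real. D 0 = g \<and>
        (\<forall>k. \<forall>t\<in>S. (D k has_real_derivative D (Suc k) t) (at t within S)))"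


definition sum_cost :: "('N::finite \<Rightarrow> real \<Rightarrow> real ^ 'n \<Rightarrow> real) \<Rightarrow> real \<Rightarrow> real ^ 'n \<Rightarrow> real" where
  "sum_cost f t x = (\<Sum>i\<in>UNIV. f i t x)"

definition stacked_cost ::
    "('N::finite \<Rightarrow> real \<Rightarrow> real ^ 'n \<Rightarrow> real) \<Rightarrow> real \<Rightarrow> real ^ ('N \<times> 'n) \<Rightarrow> real" where
  "stacked_cost f t y = (\<Sum>i\<in>UNIV. f i t (block y i))"

definition minimizer :: "('a \<Rightarrow> real) \<Rightarrow> 'a \<Rightarrow> bool" where
  "minimizer g x \<longleftrightarrow> is_arg_min g (\<lambda>_. True) x"

definition gradient_growth ::
    "('N \<Rightarrow> real \<Rightarrow> real ^ 'n \<Rightarrow> real) \<Rightarrow> real \<Rightarrow> real \<Rightarrow> real \<Rightarrow> real \<Rightarrow> real \<Rightarrow> real \<Rightarrow> bool" where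
  "gradient_growth f T0 m0 a1 b1 a2 b2 \<longleftrightarrow>
     (\<forall>x :: real \<Rightarrow> real ^ 'n.
        (\<forall>t>T0. norm (x t) \<le> a1 * sqrt t + b1) \<longrightarrow>
        (\<forall>i. \<forall>t>T0. norm (gradient (f i t) (x t)) \<le> a2 * t powr m0 + b2))"

text \<open>The argument \<open>xt\<close> maps a horizon \<open>T\<close> to the comparator used for that horizon.\<close>

definition static_regret ::
    "('N::finite \<Rightarrow> real \<Rightarrow> real ^ 'n \<Rightarrow> real) \<Rightarrow> real \<Rightarrow> ('N \<Rightarrow> real \<Rightarrow> real ^ 'n) \<Rightarrow>
     (real \<Rightarrow> real ^ 'n) \<Rightarrow> real \<Rightarrow> real" where
  "static_regret f T0 x xt T =
     integral {T0..T}
       (\<lambda>t. 1 / real CARD('N) * (\<Sum>j\<in>UNIV. \<Sum>i\<in>UNIV. f i t (x j t))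
             - stacked_cost f t (kron_vec 1 (xt T)))"

end

theory Submission
  imports Defs
begin

text \<open>
  Put \<open>a = exp \<alpha>\<close>, \<open>b = exp \<beta>\<close> and \<open>q = v / a\<close>.  In the time \<open>\<tau>\<close> with
  \<open>d\<tau> = a dt\<close> the flow is the damped oscillator \<open>x' = q\<close>, \<open>q' = - 2 q - k1 L x - b \<nabla>F\<close>,
  and \<open>\<bar>x - c + q\<bar>\<^sup>2 / 2 + \<bar>x - c\<bar>\<^sup>2 / 2 + k1 (x \<bullet> L x) / 2 + b (F x - F c)\<close> is, up to the
  integrable term coming from \<open>\<nabla>\<^sub>t F\<close>, a Lyapunov function for every consensus point \<open>c\<close>:
  it decreases at rate \<open>\<sigma> (F x - F c) + k1 a (x \<bullet> L x)\<close>.  This bounds the integral of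
  \<open>F x - F c\<close> by a constant and \<open>\<bar>x\<bar>\<close> by \<open>a1 sqrt t + b1\<close>.

  The remaining part of the regret is at most a constant times the integral of
  \<open>t powr m0\<close> times the disagreement \<open>d\<close>.  Applying Cauchy-Schwarz to the integral of
  \<open>a (x \<bullet> L x)\<close> would cost an extra factor \<open>sqrt (T - T0)\<close>, so an \<open>L\<^sup>1\<close> estimate is used instead.
  The disagreement solves the same oscillator, which is exponentially stable in \<open>\<tau>\<close>, so \<open>a d\<close> is
  controlled in \<open>L\<^sup>1\<close> by the gradients along the trajectory; and these are controlled by
  the Lyapunov function for \<open>c = 0\<close>, because a convex function that is bounded on bounded sets and
  has a bounded minimizer satisfies \<open>\<bar>\<nabla>f x\<bar> \<le> x \<bullet> \<nabla>f x + M\<close>.  With the weight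
  \<open>\<phi> = (t + b0) powr (- 1 / 2)\<close> this gives a bound \<open>O (sqrt (T - T0))\<close> on the integral of \<open>\<phi> a d\<close>,
  and \<open>m \<le> - 2 m0\<close> yields \<open>t powr m0 = O (\<phi> a)\<close>.  The constants \<open>\<rho>\<close> and \<open>\<omega>\<close>
  are then chosen large enough to absorb everything.
\<close>

subsection \<open>Gradients\<close>

lemma has_vector_derivative_vec_lambda:
  fixes z :: "'N::finite \<Rightarrow> real \<Rightarrow> real ^ 'n"
  assumes "\<And>i. (z i has_vector_derivative z' i) (at t within S)"
  shows "((\<lambda>s. \<chi> i. z i s) has_vector_derivative (\<chi> i. z' i)) (at t within S)"
  unfolding has_vector_derivative_def
proof (subst has_derivative_componentwise_within, intro ballI)
  fix e :: "(real ^ 'n) ^ 'N" assume "e \<in> Basis"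
  then obtain i u where e: "e = axis i u" by (auto simp: Basis_vec_def)
  have "((\<lambda>s. z i s) has_derivative (\<lambda>h. h *\<^sub>R z' i)) (at t within S)"
    using assms[of i] by (simp add: has_vector_derivative_def)
  from has_derivative_inner_left[OF this, of u]
  show "((\<lambda>s. (\<chi> i. z i s) \<bullet> e) has_derivative (\<lambda>h. h *\<^sub>R (\<chi> i. z' i) \<bullet> e)) (at t within S)"
    by (simp add: e inner_axis)
qed

lemma gradient_eqI:
  fixes g :: "'a::real_inner \<Rightarrow> real"
  assumes "GDERIV g x :> D"
  shows "gradient g x = D"
  unfolding gradient_def
proof (rule the_equality[of "\<lambda>D. GDERIV g x :> D", OF assms])
  fix D' assume "GDERIV g x :> D'"
  then have "(\<lambda>h. h \<bullet> D') = (\<lambda>h. h \<bullet> D)"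
    using assms unfolding gderiv_def by (rule has_derivative_unique)
  then show "D' = D" by (metis vector_eq_ldot)
qed

text \<open>The derivative within the half space \<open>{T0..} \<times> UNIV\<close> is composed
  with two maps that stay inside it: a time slice, which gives a full spatial gradient even at
  \<open>t = T0\<close>, and the curve \<open>(s, z s)\<close>, which gives the chain rule. The
  value \<open>d t y\<close> is the partial derivative in time.\<close>

lemma C1_on_chain:
  fixes h :: "real \<Rightarrow> 'a::euclidean_space \<Rightarrow> real"
  assumes "C1_on ({T0..} \<times> UNIV) (\<lambda>(t, y). h t y)"
  obtains d where "\<And>t y. t \<ge> T0 \<Longrightarrow> GDERIV (h t) y :> gradient (h t) y"
    and "\<And>t z z'. t \<ge> T0 \<Longrightarrow> (z has_vector_derivative z') (at t within {T0..}) \<Longrightarrow>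
      ((\<lambda>s. h s (z s)) has_real_derivative d t (z t) + gradient (h t) (z t) \<bullet> z') (at t within {T0..})"
proof -
  let ?S = "{T0..} \<times> (UNIV :: 'a set)"
  obtain D :: "real \<times> 'a \<Rightarrow> (real \<times> 'a) \<Rightarrow>\<^sub>L real" where
    D: "\<And>p. p \<in> ?S \<Longrightarrow> ((\<lambda>(t, y). h t y) has_derivative blinfun_apply (D p)) (at p within ?S)"
    using assms unfolding C1_on_def by blast
  \<comment> \<open>The adjoint evaluated at 1 is the Riesz representative of the spatial part of
    the differential.\<close>
  define g where "g t y = adjoint (\<lambda>k. blinfun_apply (D (t, y)) (0, k)) 1" for t y
  have lin: "linear (\<lambda>k. blinfun_apply (D p) (0, k))" for p
    using blinfun.add_right[of "D p" "(0, _)" "(0, _)"] blinfun.scaleR_right[of "D p" _ "(0, _)"]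
    by (intro linearI) simp_all
  have g: "blinfun_apply (D (t, y)) (0, k) = k \<bullet> g t y" for t y k
    using adjoint_works[OF lin, of k "(t, y)" 1] by (simp add: g_def)
  have grad: "GDERIV (h t) y :> g t y" if "t \<ge> T0" for t y
  proof -
    have "((\<lambda>y. (t, y)) has_derivative (\<lambda>k. (0, k))) (at y)"
      by (auto intro!: derivative_eq_intros)
    then have "((\<lambda>y. (\<lambda>(t, y). h t y) (t, y)) has_derivative (\<lambda>k. blinfun_apply (D (t, y)) (0, k))) (at y)"
      by (rule has_derivative_in_compose2[OF D, rotated -1]) (use that in auto)
    then show ?thesis by (simp add: gderiv_def g)
  qed
  have eq: "gradient (h t) y = g t y" if "t \<ge> T0" for t y
    by (rule gradient_eqI[OF grad[OF that]])
  show ?thesis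
  proof (rule that[of "\<lambda>t y. blinfun_apply (D (t, y)) (1, 0)"])
    show "GDERIV (h t) y :> gradient (h t) y" if "t \<ge> T0" for t y
      using grad[OF that] eq[OF that] by simp
    fix t and z :: "real \<Rightarrow> 'a" and z' assume t: "t \<ge> T0" and z: "(z has_vector_derivative z') (at t within {T0..})"
    have "((\<lambda>s. (s, z s)) has_derivative (\<lambda>k. (k, k *\<^sub>R z'))) (at t within {T0..})"
      using z unfolding has_vector_derivative_def by (auto intro!: derivative_eq_intros)
    then have "((\<lambda>s. (\<lambda>(t, y). h t y) (s, z s)) has_derivative
        (\<lambda>k. blinfun_apply (D (t, z t)) (k, k *\<^sub>R z'))) (at t within {T0..})"
      by (rule has_derivative_in_compose2[OF D, rotated -1]) (use t in auto)
    moreover have "blinfun_apply (D (t, z t)) (k, k *\<^sub>R z')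
       = (blinfun_apply (D (t, z t)) (1, 0) + gradient (h t) (z t) \<bullet> z') * k" for k
    proof -
      have "(k, k *\<^sub>R z') = k *\<^sub>R ((1, 0) + (0, z'))" by simp
      then have "blinfun_apply (D (t, z t)) (k, k *\<^sub>R z')
        = k * (blinfun_apply (D (t, z t)) (1, 0) + blinfun_apply (D (t, z t)) (0, z'))"
        by (simp only: blinfun.add_right blinfun.scaleR_right real_scaleR_def)
      then show ?thesis by (simp add: g eq[OF t] inner_commute)
    qed
    ultimately show "((\<lambda>s. h s (z s)) has_real_derivative
       blinfun_apply (D (t, z t)) (1, 0) + gradient (h t) (z t) \<bullet> z') (at t within {T0..})"
      by (simp add: has_field_derivative_def)
  qed
qed

text \<open>Restriction to the line through \<open>y\<close> and \<open>z\<close> reduces this to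
  the tangent inequality for convex functions of one variable.\<close>

lemma convex_on_above_gradient:
  fixes f :: "'a::real_inner \<Rightarrow> real"
  assumes "convex_on UNIV f" "GDERIV f y :> D"
  shows "f z \<ge> f y + D \<bullet> (z - y)"
proof -
  let ?l = "\<lambda>s. y + s *\<^sub>R (z - y)"
  have "convex_on UNIV (\<lambda>s. f (?l s))"
  proof (rule convex_onI)
    fix \<theta> s r :: real assume "0 < \<theta>" "\<theta> < 1"
    moreover have "?l ((1 - \<theta>) *\<^sub>R s + \<theta> *\<^sub>R r) = (1 - \<theta>) *\<^sub>R ?l s + \<theta> *\<^sub>R ?l r"
      by (simp add: algebra_simps)
    ultimately show "f (?l ((1 - \<theta>) *\<^sub>R s + \<theta> *\<^sub>R r)) \<le> (1 - \<theta>) * f (?l s) + \<theta> * f (?l r)"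
      using convex_onD[OF assms(1), of \<theta> "?l s" "?l r"] by simp
  qed auto
  moreover have "((\<lambda>s. f (?l s)) has_real_derivative D \<bullet> (z - y)) (at 0)"
  proof -
    have "((\<lambda>s. ?l s) has_derivative (\<lambda>s. s *\<^sub>R (z - y))) (at 0)"
      by (auto intro!: derivative_eq_intros)
    from has_derivative_compose[OF this, of f "\<lambda>h. h \<bullet> D"] assms(2)
    show ?thesis by (simp add: gderiv_def has_field_derivative_def inner_commute mult.commute[of _ "D \<bullet> _"] flip: scaleR_conv_of_real)
  qed
  ultimately have "f (?l 1) - f (?l 0) \<ge> (D \<bullet> (z - y)) * (1 - 0)"
    by (intro convex_on_imp_above_tangent[where A = UNIV]) auto
  then show ?thesis by simp
qed

text \<open>A convex function that is bounded below and bounded on a ball has a gradient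
  pointing outwards wherever it is large.\<close>

lemma convex_gradient_outward:
  fixes f :: "'a::real_inner \<Rightarrow> real"
  assumes "convex_on UNIV f" "GDERIV f y :> D" "r \<ge> 0"
    and "\<And>z. norm z \<le> r \<Longrightarrow> f z \<le> M" "f y \<ge> - B"
  shows "r * norm D \<le> y \<bullet> D + M + B"
proof -
  \<comment> \<open>The tangent inequality at \<open>y\<close> is tested at the point of norm
    \<open>r\<close> in the direction of \<open>D\<close>; for \<open>D = 0\<close> the convention
    \<open>sgn 0 = 0\<close> replaces it by the origin.\<close>
  have "f (r *\<^sub>R sgn D) \<le> M"
    using assms(3) by (intro assms(4)) (simp add: norm_sgn)
  moreover have "D \<bullet> (r *\<^sub>R sgn D) = r * norm D"
    by (cases "D = 0") (simp_all add: sgn_div_norm power2_norm_eq_inner[symmetric] power2_eq_square)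
  ultimately show ?thesis
    using convex_on_above_gradient[OF assms(1,2), of "r *\<^sub>R sgn D"] assms(5)
    unfolding inner_diff_right inner_commute[of y D] by linarith
qed

text \<open>Makes derivatives within \<open>{T0..}\<close> unique, also at the endpoint, so that
  \<open>vector_derivative\<close> can be evaluated there.\<close>

lemma at_within_atLeast_neq_bot: "t \<ge> T0 \<Longrightarrow> at t within {T0..} \<noteq> (bot :: real filter)"
proof -
  assume "t \<ge> T0"
  then have "at_right t \<le> at t within {T0..}" by (intro at_le) auto
  then show ?thesis using trivial_limit_at_right_real[of t] by (metis bot.extremum_unique)
qed

text \<open>Only the exponential of \<open>\<alpha>\<close> is prescribed. Writing
  \<open>\<alpha>\<close> as \<open>ln h\<close> shows that it is differentiable, which gives the
  \<open>vector_derivative\<close> in the equation of motion its intended meaning.\<close>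

lemma has_derivative_of_exp_eq:
  fixes \<alpha> h :: "real \<Rightarrow> real"
  assumes t: "t \<ge> T0" and \<alpha>: "\<And>t. t \<ge> T0 \<Longrightarrow> exp (\<alpha> t) = h t"
    and h: "(h has_real_derivative D) (at t within {T0..})"
  shows "(\<alpha> has_real_derivative vector_derivative \<alpha> (at t within {T0..})) (at t within {T0..})"
proof -
  have "h t > 0" using \<alpha>[OF t] exp_gt_zero[of "\<alpha> t"] by simp
  from DERIV_chain2[OF DERIV_ln[OF this] h]
  have "((\<lambda>s. ln (h s)) has_real_derivative inverse (h t) * D) (at t within {T0..})" .
  moreover have "ln (h s) = \<alpha> s" if "s \<ge> T0" for s using \<alpha>[OF that] by (metis ln_exp)
  ultimately have "(\<alpha> has_vector_derivative inverse (h t) * D) (at t within {T0..})"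
    using has_vector_derivative_transform[of t "{T0..}" \<alpha> "\<lambda>s. ln (h s)"] t
    by (simp add: has_real_derivative_iff_has_vector_derivative)
  then show ?thesis
    using vector_derivative_within[OF at_within_atLeast_neq_bot[OF t]]
    by (metis has_real_derivative_iff_has_vector_derivative)
qed

text \<open>If \<open>D\<close> is the logarithmic derivative of \<open>u\<close>, the left side is
  the derivative of \<open>v / u\<close>. The terms with \<open>D\<close> cancel, which leaves the
  constant friction coefficient 2.\<close>

lemma rescaled_acceleration:
  fixes v :: "'a::real_vector"
  assumes "u > 0" "acc + (2 * u - D) *\<^sub>R v + (u * u * b) *\<^sub>R g + (k * (u * u)) *\<^sub>R l = 0"
  shows "(1 / u) *\<^sub>R acc + (- (1 / u) * D) *\<^sub>R v
    = u *\<^sub>R (- 2 *\<^sub>R ((1 / u) *\<^sub>R v) - k *\<^sub>R l - b *\<^sub>R g)"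
proof -
  have acc: "acc = - ((2 * u - D) *\<^sub>R v + (u * u * b) *\<^sub>R g + (k * (u * u)) *\<^sub>R l)"
    unfolding eq_neg_iff_add_eq_0 using assms(2) by (simp only: add.assoc)
  show ?thesis unfolding acc using assms(1) by (simp add: algebra_simps)
qed

subsection \<open>The graph Laplacian\<close>

text \<open>This is \<open>laplacian A\<close> tensored with the identity, acting on vectors whose
  components are the states of the agents.\<close>

definition lap_op :: "real ^ 'N ^ 'N \<Rightarrow> (real ^ 'n) ^ 'N \<Rightarrow> (real ^ 'n) ^ 'N" where
  "lap_op A y = (\<chi> i. \<Sum>j\<in>UNIV. A $ i $ j *\<^sub>R (y $ i - y $ j))"

text \<open>The orthogonal projection onto the disagreement space, that is, the vectors whose
  components sum to zero.\<close>

definition center :: "(real ^ 'n) ^ 'N \<Rightarrow> (real ^ 'n) ^ 'N" where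
  "center y = (\<chi> i. y $ i - (1 / real CARD('N)) *\<^sub>R (\<Sum>j\<in>UNIV. y $ j))"

lemma linear_lap_op: "linear (lap_op A)"
  by (rule linearI)
    (simp_all add: lap_op_def vec_eq_iff sum.distrib[symmetric] sum_distrib_left algebra_simps
      scaleR_sum_right)

lemma linear_center: "linear center"
  by (rule linearI)
    (simp_all add: center_def vec_eq_iff sum.distrib algebra_simps scaleR_sum_right flip: sum_distrib_left)

text \<open>The double sum is averaged with its copy in which \<open>i\<close> and \<open>j\<close>
  are exchanged. Self-adjointness and nonnegativity can be read off the symmetric form.\<close>

lemma inner_lap_op:
  assumes "transpose A = A"
  shows "y \<bullet> lap_op A z = (\<Sum>i\<in>UNIV. \<Sum>j\<in>UNIV. A $ i $ j * ((y $ i - y $ j) \<bullet> (z $ i - z $ j))) / 2"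
proof -
  have sym: "A $ i $ j = A $ j $ i" for i j
    using assms by (metis transpose_def vec_lambda_beta)
  have 1: "y \<bullet> lap_op A z = (\<Sum>i\<in>UNIV. \<Sum>j\<in>UNIV. A $ i $ j * (y $ i \<bullet> (z $ i - z $ j)))"
    by (simp add: inner_vec_def[of y] lap_op_def inner_sum_right)
  also have "\<dots> = (\<Sum>j\<in>UNIV. \<Sum>i\<in>UNIV. A $ i $ j * (y $ i \<bullet> (z $ i - z $ j)))"
    by (rule sum.swap)
  also have "\<dots> = (\<Sum>i\<in>UNIV. \<Sum>j\<in>UNIV. - (A $ i $ j * (y $ j \<bullet> (z $ i - z $ j))))"
    by (intro sum.cong refl) (subst sym, simp add: inner_diff_right algebra_simps)
  finally have "2 * (y \<bullet> lap_op A z) = (\<Sum>i\<in>UNIV. \<Sum>j\<in>UNIV. A $ i $ j * (y $ i \<bullet> (z $ i - z $ j)))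
      + (\<Sum>i\<in>UNIV. \<Sum>j\<in>UNIV. - (A $ i $ j * (y $ j \<bullet> (z $ i - z $ j))))"
    using 1 by simp
  then show ?thesis
    by (simp add: sum.distrib[symmetric] inner_diff_left algebra_simps)
qed

lemma lap_op_selfadjoint: "transpose A = A \<Longrightarrow> y \<bullet> lap_op A z = lap_op A y \<bullet> z"
  by (subst (2) inner_commute) (simp add: inner_lap_op inner_commute)

text \<open>Translates the quadratic form of the statement into the one used in the proof; the
  identity factor leaves only the summands with equal coordinates.\<close>

lemma inner_stack_kron_laplacian:
  fixes x :: "'N::finite \<Rightarrow> real ^ 'n"
  shows "stack x \<bullet> (kron (laplacian A) (mat 1) *v stack x) = (\<chi> i. x i) \<bullet> lap_op A (\<chi> i. x i)"
proof -
  have mv: "(kron (laplacian A) (mat 1) *v stack x) $ (i, k) = lap_op A (\<chi> i. x i) $ i $ k" for i k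
  proof -
    have "(kron (laplacian A) (mat 1) *v stack x) $ (i, k)
      = (\<Sum>q\<in>UNIV \<times> UNIV. laplacian A $ i $ fst q * (mat 1 :: real ^ 'n ^ 'n) $ k $ snd q * (x (fst q) $ snd q))"
      by (simp add: matrix_vector_mult_def kron_def stack_def)
    also have "\<dots> = (\<Sum>j\<in>UNIV. \<Sum>l\<in>UNIV. laplacian A $ i $ j * (mat 1 :: real ^ 'n ^ 'n) $ k $ l * (x j $ l))"
      by (simp add: sum.cartesian_product case_prod_unfold)
    also have "\<dots> = (\<Sum>j\<in>UNIV. laplacian A $ i $ j * x j $ k)"
    proof (rule sum.cong[OF refl])
      fix j :: 'N
      have "(\<Sum>l\<in>UNIV. laplacian A $ i $ j * (mat 1 :: real ^ 'n ^ 'n) $ k $ l * (x j $ l))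
         = (\<Sum>l\<in>UNIV. if k = l then laplacian A $ i $ j * x j $ l else 0)"
        by (intro sum.cong) (auto simp: mat_def)
      then show "(\<Sum>l\<in>UNIV. laplacian A $ i $ j * (mat 1 :: real ^ 'n ^ 'n) $ k $ l * (x j $ l)) = laplacian A $ i $ j * x j $ k"
        by simp
    qed
    also have "\<dots> = (\<Sum>j\<in>UNIV. (if i = j then (\<Sum>l\<in>UNIV. A $ i $ l) * x j $ k else 0) - A $ i $ j * x j $ k)"
      by (intro sum.cong) (auto simp: laplacian_def degree_matrix_def algebra_simps)
    also have "\<dots> = (\<Sum>l\<in>UNIV. A $ i $ l) * x i $ k - (\<Sum>j\<in>UNIV. A $ i $ j * x j $ k)"
      by (simp add: sum_subtractf)
    also have "\<dots> = lap_op A (\<chi> i. x i) $ i $ k"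
      by (simp add: lap_op_def sum_distrib_left algebra_simps sum_subtractf)
    finally show ?thesis .
  qed
  have "stack x \<bullet> (kron (laplacian A) (mat 1) *v stack x)
    = (\<Sum>q\<in>UNIV \<times> UNIV. x (fst q) $ snd q * (kron (laplacian A) (mat 1) *v stack x) $ (fst q, snd q))"
    by (simp add: inner_vec_def stack_def)
  also have "\<dots> = (\<Sum>i\<in>UNIV. \<Sum>k\<in>UNIV. x i $ k * lap_op A (\<chi> i. x i) $ i $ k)"
    unfolding mv by (simp add: sum.cartesian_product case_prod_unfold)
  also have "\<dots> = (\<chi> i. x i) \<bullet> lap_op A (\<chi> i. x i)"
    by (simp add: inner_vec_def)
  finally show ?thesis .
qed

lemma sum_center: "(\<Sum>i\<in>UNIV. center y $ i) = 0"
  by (simp add: center_def sum_subtractf scaleR_sum_right[symmetric] sum_constant_scaleR del: sum_constant)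

lemma center_eq_self: "(\<Sum>i\<in>UNIV. y $ i) = 0 \<Longrightarrow> center y = y"
  by (simp add: center_def vec_eq_iff)

lemma center_idem: "center (center y) = center y"
  by (rule center_eq_self[OF sum_center])

lemma inner_center: "y \<bullet> center z = center y \<bullet> z"
  by (simp add: center_def inner_vec_def[of y] inner_vec_def[of _ z] inner_diff_left inner_diff_right sum_subtractf
     sum_divide_distrib[symmetric] inner_sum_right[symmetric] inner_sum_left[symmetric])

lemma lap_op_center: "lap_op A (center y) = lap_op A y"
  by (simp add: lap_op_def center_def)

text \<open>By symmetry of \<open>A\<close>, exchanging the indices turns the sum of all components
  into its negative, so it vanishes.\<close>

lemma center_lap_op:
  assumes "transpose A = A"
  shows "center (lap_op A y) = lap_op A y"
proof (rule center_eq_self)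
  have sym: "A $ i $ j = A $ j $ i" for i j
    using assms by (metis transpose_def vec_lambda_beta)
  let ?s = "\<Sum>i\<in>UNIV. \<Sum>j\<in>UNIV. A $ i $ j *\<^sub>R (y $ i - y $ j)"
  have "?s = (\<Sum>j\<in>UNIV. \<Sum>i\<in>UNIV. A $ i $ j *\<^sub>R (y $ i - y $ j))" by (rule sum.swap)
  also have "\<dots> = (\<Sum>i\<in>UNIV. \<Sum>j\<in>UNIV. - (A $ i $ j *\<^sub>R (y $ i - y $ j)))"
    by (intro sum.cong refl) (subst sym, simp add: algebra_simps)
  also have "\<dots> = - ?s" by (simp add: sum_negf)
  finally have "?s = - ?s" .
  then have "2 *\<^sub>R ?s = 0" unfolding scaleR_2 using eq_neg_iff_add_eq_0 by blast
  then have "?s = 0" by (metis (no_types) scaleR_eq_0_iff zero_neq_numeral)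
  then show "(\<Sum>i\<in>UNIV. lap_op A y $ i) = 0" by (simp add: lap_op_def)
qed

lemma norm_vec_le_sum: "norm (y :: (real ^ 'n) ^ 'N) \<le> (\<Sum>i\<in>UNIV. norm (y $ i))"
  unfolding norm_vec_def by (intro L2_set_le_sum) auto

text \<open>A discrete Poincare inequality. Differences between two agents are telescoped along a
  path joining them, each edge of which is controlled by the quadratic form.\<close>

lemma connected_graph_coercive:
  fixes A :: "real ^ 'N::finite ^ 'N"
  assumes "connected_weighted_graph E A"
  obtains \<Lambda> where "\<Lambda> > 0" "\<And>y :: (real ^ 'n) ^ 'N. (norm (center y))\<^sup>2 \<le> \<Lambda> * (y \<bullet> lap_op A y)"
    "\<And>y :: (real ^ 'n) ^ 'N. y \<bullet> lap_op A y \<ge> 0"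
proof -
  have sym: "transpose A = A" and pos: "\<And>i j. (j, i) \<in> E \<Longrightarrow> A $ i $ j > 0"
    and conn: "\<And>i j. (i, j) \<in> E\<^sup>*" and zero: "\<And>i j. (j, i) \<notin> E \<Longrightarrow> A $ i $ j = 0"
    using assms unfolding connected_weighted_graph_def by auto
  have nn: "A $ i $ j \<ge> 0" for i j using pos[of j i] zero[of j i] by (cases "(j, i) \<in> E") auto
  have S: "y \<bullet> lap_op A y = (\<Sum>i\<in>UNIV. \<Sum>j\<in>UNIV. A $ i $ j * (norm (y $ i - y $ j))\<^sup>2) / 2" for y :: "(real ^ 'n) ^ 'N"
    by (simp add: inner_lap_op[OF sym] power2_norm_eq_inner)
  have S0: "y \<bullet> lap_op A y \<ge> 0" for y :: "(real ^ 'n) ^ 'N"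
    unfolding S using nn by (intro divide_nonneg_pos sum_nonneg mult_nonneg_nonneg) auto
  have edge: "A $ i $ j * (norm (y $ i - y $ j))\<^sup>2 \<le> 2 * (y \<bullet> lap_op A y)" for i j and y :: "(real ^ 'n) ^ 'N"
  proof -
    have "A $ i $ j * (norm (y $ i - y $ j))\<^sup>2 \<le> (\<Sum>j\<in>UNIV. A $ i $ j * (norm (y $ i - y $ j))\<^sup>2)"
      using nn by (intro member_le_sum) auto
    also have "\<dots> \<le> (\<Sum>i\<in>UNIV. \<Sum>j\<in>UNIV. A $ i $ j * (norm (y $ i - y $ j))\<^sup>2)"
      using nn by (intro member_le_sum[where f = "\<lambda>i. \<Sum>j\<in>UNIV. A $ i $ j * (norm (y $ i - y $ j))\<^sup>2"] sum_nonneg) auto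
    finally show ?thesis unfolding S by simp
  qed
  \<comment> \<open>Induction along a path from \<open>i\<close> to \<open>j\<close>: every further
    edge adds the square root of 2 over its weight to the constant.\<close>
  have "\<exists>c\<ge>0. \<forall>y :: (real ^ 'n) ^ 'N. norm (y $ i - y $ j) \<le> c * sqrt (y \<bullet> lap_op A y)" for i j
    using conn[of i j]
  proof (induction rule: rtrancl_induct)
    case base
    show ?case by (intro exI[of _ 0]) auto
  next
    case (step j l)
    then obtain c where c: "c \<ge> 0" "\<And>y :: (real ^ 'n) ^ 'N. norm (y $ i - y $ j) \<le> c * sqrt (y \<bullet> lap_op A y)" by auto
    let ?d = "sqrt (2 / A $ l $ j)"
    have a: "A $ l $ j > 0" using step pos by auto
    have "norm (y $ j - y $ l) \<le> ?d * sqrt (y \<bullet> lap_op A y)" for y :: "(real ^ 'n) ^ 'N"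
    proof -
      have "(norm (y $ j - y $ l))\<^sup>2 \<le> 2 / A $ l $ j * (y \<bullet> lap_op A y)"
        using edge[where i = l and j = j and y = y] a by (simp add: field_simps norm_minus_commute)
      then show ?thesis unfolding real_sqrt_mult[symmetric] by (rule real_le_rsqrt)
    qed
    then have "norm (y $ i - y $ l) \<le> (c + ?d) * sqrt (y \<bullet> lap_op A y)" for y :: "(real ^ 'n) ^ 'N"
      using norm_triangle_ineq[of "y $ i - y $ j" "y $ j - y $ l"] c(2)[of y]
      by (auto simp: algebra_simps intro: order_trans[OF _ add_mono])
    then show ?case using c(1) a by (intro exI[of _ "c + ?d"]) auto
  qed
  then obtain c where c: "\<And>i j. c i j \<ge> 0"
    "\<And>i j (y :: (real ^ 'n) ^ 'N). norm (y $ i - y $ j) \<le> c i j * sqrt (y \<bullet> lap_op A y)" by metis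
  define c' where "c' = (\<Sum>i\<in>UNIV. \<Sum>j\<in>UNIV. c i j)"
  have n: "norm (center y) \<le> c' * sqrt (y \<bullet> lap_op A y)" for y :: "(real ^ 'n) ^ 'N"
  proof -
    have "norm (center y $ i) \<le> (\<Sum>j\<in>UNIV. c i j) * sqrt (y \<bullet> lap_op A y)" for i
    proof -
      have "center y $ i = (1 / real CARD('N)) *\<^sub>R (\<Sum>j\<in>UNIV. y $ i - y $ j)"
        by (simp add: center_def sum_subtractf scaleR_diff_right sum_constant_scaleR del: sum_constant)
      then have "norm (center y $ i) = (1 / real CARD('N)) * norm (\<Sum>j\<in>UNIV. y $ i - y $ j)" by simp
      also have "\<dots> \<le> 1 * norm (\<Sum>j\<in>UNIV. y $ i - y $ j)"
        by (intro mult_right_mono) auto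
      also have "\<dots> \<le> (\<Sum>j\<in>UNIV. c i j * sqrt (y \<bullet> lap_op A y))"
        by (simp only: mult_1) (intro sum_norm_le c)
      finally show ?thesis by (simp add: sum_distrib_right)
    qed
    then have "(\<Sum>i\<in>UNIV. norm (center y $ i)) \<le> (\<Sum>i\<in>UNIV. (\<Sum>j\<in>UNIV. c i j) * sqrt (y \<bullet> lap_op A y))"
      by (intro sum_mono)
    then show ?thesis using norm_vec_le_sum[of "center y"] unfolding c'_def sum_distrib_right by linarith
  qed
  have c'0: "c' \<ge> 0" unfolding c'_def using c(1) by (intro sum_nonneg)
  \<comment> \<open>The added 1 keeps the constant strictly positive even if \<open>c'\<close> is
    zero.\<close>
  have "(norm (center y))\<^sup>2 \<le> (c'\<^sup>2 + 1) * (y \<bullet> lap_op A y)" for y :: "(real ^ 'n) ^ 'N"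
  proof -
    have "(norm (center y))\<^sup>2 \<le> (c' * sqrt (y \<bullet> lap_op A y))\<^sup>2" using n by (intro power_mono) auto
    also have "\<dots> = c'\<^sup>2 * (y \<bullet> lap_op A y)" using S0[of y] by (simp add: power_mult_distrib)
    also have "\<dots> \<le> (c'\<^sup>2 + 1) * (y \<bullet> lap_op A y)" using S0[of y] by (intro mult_right_mono) auto
    finally show ?thesis .
  qed
  then show ?thesis using S0 by (intro that[of "c'\<^sup>2 + 1"]) (auto intro: add_nonneg_pos)
qed

subsection \<open>The damped flow\<close>

definition energy :: "('e::euclidean_space \<Rightarrow> 'e) \<Rightarrow> real \<Rightarrow> 'e \<Rightarrow> 'e \<Rightarrow> real" where
  "energy L k y p = (norm (y + p))\<^sup>2 / 2 + (norm y)\<^sup>2 / 2 + k * (y \<bullet> L y) / 2"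

text \<open>In rescaled time \<open>y + p\<close> has derivative \<open>- p - k L y - h\<close>. The
  product of \<open>y\<close> and \<open>p\<close> cancels against the second square, and that of
  \<open>p\<close> and \<open>k L y\<close> against the potential term; what remains dissipates both
  velocity and disagreement.\<close>

lemma energy_has_derivative:
  fixes L :: "'e::euclidean_space \<Rightarrow> 'e"
  assumes L: "linear L" "\<And>y z. y \<bullet> L z = L y \<bullet> z"
    and y: "(y has_vector_derivative a *\<^sub>R p t) (at t within S)"
    and p: "(p has_vector_derivative a *\<^sub>R (- 2 *\<^sub>R p t - k *\<^sub>R L (y t) - h)) (at t within S)"
  shows "((\<lambda>s. energy L k (y s) (p s)) has_real_derivative
           - a * ((norm (p t))\<^sup>2 + k * (y t \<bullet> L (y t)) + (y t + p t) \<bullet> h)) (at t within S)"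
proof -
  have bl: "bounded_linear L" using L(1) by (simp add: linear_conv_bounded_linear)
  have Ly: "((\<lambda>s. L (y s)) has_vector_derivative a *\<^sub>R L (p t)) (at t within S)"
    using bounded_linear.has_vector_derivative[OF bl y] L(1) by (simp add: linear_scale)
  have yp: "((\<lambda>s. y s + p s) has_vector_derivative
      a *\<^sub>R p t + a *\<^sub>R (- 2 *\<^sub>R p t - k *\<^sub>R L (y t) - h)) (at t within S)"
    by (rule has_vector_derivative_add[OF y p])
  note inner' = bounded_bilinear.has_vector_derivative[OF bounded_bilinear_inner]
  show ?thesis
    unfolding energy_def power2_norm_eq_inner has_real_derivative_iff_has_vector_derivative
    apply (rule has_vector_derivative_eq_rhs)
     apply (rule has_vector_derivative_add[OF has_vector_derivative_add])
       apply (rule has_vector_derivative_divide[OF inner'[OF yp yp]])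
      apply (rule has_vector_derivative_divide[OF inner'[OF y y]])
     apply (rule has_vector_derivative_divide[OF has_vector_derivative_mult_right[OF inner'[OF y Ly]]])
    using L(2)[of "p t" "y t"]
    apply (simp add: inner_add_left inner_add_right inner_diff_left inner_diff_right inner_commute algebra_simps)
    apply (simp add: field_simps)
    done
qed

lemma energy_bounds:
  assumes "y \<bullet> L y \<ge> 0" "k \<ge> 0"
  shows "(norm y)\<^sup>2 \<le> 2 * energy L k y p" "(norm (y + p))\<^sup>2 \<le> 2 * energy L k y p"
    "energy L k y p \<ge> 0"
  using assms unfolding energy_def by auto

text \<open>Integrability of \<open>\<Psi>'\<close> comes from the fundamental theorem of calculus
  rather than from continuity, because the flow below carries no continuity assumption on
  \<open>G\<close> or \<open>d\<Phi>\<close>.\<close>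

lemma integral_le_lyapunov_decrease:
  fixes \<Psi> h :: "real \<Rightarrow> real"
  assumes "T0 \<le> T" and deriv: "\<And>t. t \<ge> T0 \<Longrightarrow> (\<Psi> has_real_derivative \<Psi>' t) (at t within {T0..})"
    and le: "\<And>t. t \<ge> T0 \<Longrightarrow> \<Psi>' t \<le> - h t" and h: "h integrable_on {T0..T}"
  shows "integral {T0..T} h \<le> \<Psi> T0 - \<Psi> T"
proof -
  have "(\<Psi>' has_integral \<Psi> T - \<Psi> T0) {T0..T}"
    using assms(1) by (intro fundamental_theorem_of_calculus)
      (auto simp: has_real_derivative_iff_has_vector_derivative[symmetric] intro: DERIV_subset[OF deriv])
  moreover have "((\<lambda>t. - h t) has_integral - integral {T0..T} h) {T0..T}"
    using h by (intro has_integral_neg) (simp add: integrable_integral)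
  ultimately have "\<Psi> T - \<Psi> T0 \<le> - integral {T0..T} h"
    by (rule has_integral_le) (use le in auto)
  then show ?thesis by simp
qed

text \<open>
  \<open>\<Phi>\<close> is the stacked cost with time derivative \<open>d\<Phi>\<close> and gradient \<open>G\<close>, \<open>Q\<close> is the
  velocity divided by \<open>exp \<alpha>\<close>, \<open>P\<close> is the projection onto the disagreement space and \<open>K\<close> is the
  set of admissible comparators.
\<close>

locale damped_flow =
  fixes L P :: "'e::euclidean_space \<Rightarrow> 'e" and \<Phi> d\<Phi> :: "real \<Rightarrow> 'e \<Rightarrow> real"
    and G :: "real \<Rightarrow> 'e \<Rightarrow> 'e" and X Q :: "real \<Rightarrow> 'e" and K :: "'e set"
    and T0 b0 m \<sigma> k C \<rho> M \<Lambda> :: real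
  assumes L: "linear L" "\<And>y z. y \<bullet> L z = L y \<bullet> z" "\<And>y. y \<bullet> L y \<ge> 0"
    and P: "linear P" "\<And>y z. y \<bullet> P z = P y \<bullet> z" "\<And>y. P (P y) = P y"
      "\<And>y. L (P y) = L y" "\<And>y. P (L y) = L y"
    and coercive: "\<Lambda> > 0" "\<And>y. (norm (P y))\<^sup>2 \<le> \<Lambda> * (y \<bullet> L y)"
    and convex: "\<And>t y z. t \<ge> T0 \<Longrightarrow> \<Phi> t z \<ge> \<Phi> t y + G t y \<bullet> (z - y)"
    and chain: "\<And>t z z'. t \<ge> T0 \<Longrightarrow> (z has_vector_derivative z') (at t within {T0..}) \<Longrightarrow>
      ((\<lambda>s. \<Phi> s (z s)) has_real_derivative d\<Phi> t (z t) + G t (z t) \<bullet> z') (at t within {T0..})"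
    and d\<Phi>: "\<And>t y. t \<ge> T0 \<Longrightarrow> \<bar>d\<Phi> t y\<bar> \<le> C"
    and K: "0 \<in> K" "\<And>c. c \<in> K \<Longrightarrow> L c = 0"
      "\<And>c t y. c \<in> K \<Longrightarrow> t \<ge> T0 \<Longrightarrow> \<Phi> t y \<ge> \<Phi> t c - \<rho>"
    and coercive_grad: "\<And>t y. t \<ge> T0 \<Longrightarrow> norm (G t y) \<le> y \<bullet> G t y + M"
    and X: "\<And>t. t \<ge> T0 \<Longrightarrow> (X has_vector_derivative
      (m * (t + b0) powr (- 1) + \<sigma> * (t + b0) powr (- m)) *\<^sub>R Q t) (at t within {T0..})"
    and Q: "\<And>t. t \<ge> T0 \<Longrightarrow> (Q has_vector_derivative
      (m * (t + b0) powr (- 1) + \<sigma> * (t + b0) powr (- m)) *\<^sub>R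
        (- 2 *\<^sub>R Q t - k *\<^sub>R L (X t) - (t + b0) powr m *\<^sub>R G t (X t))) (at t within {T0..})"
    and params: "T0 \<ge> 0" "b0 \<ge> 1" "m < - 1" "\<sigma> > 0" "k > 0"
    and rate_pos: "\<And>t. t \<ge> T0 \<Longrightarrow> m * (t + b0) powr (- 1) + \<sigma> * (t + b0) powr (- m) > 0"
begin

definition a :: "real \<Rightarrow> real" where "a t = m * (t + b0) powr (- 1) + \<sigma> * (t + b0) powr (- m)"
definition b :: "real \<Rightarrow> real" where "b t = (t + b0) powr m"

text \<open>A primitive of \<open>- b\<close> that compensates the bounded time derivative of the cost.\<close>

definition \<eta> :: "real \<Rightarrow> real" where "\<eta> t = (t + b0) powr (m + 1) / (- (m + 1))"
text \<open>Half a primitive of \<open>\<phi>\<close> is \<open>sqrt (t + b0)\<close>, so a bounded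
  rate weighted by \<open>\<phi>\<close> accumulates only \<open>O (sqrt (T - T0))\<close>.\<close>

definition \<phi> :: "real \<Rightarrow> real" where "\<phi> t = (t + b0) powr (- 1 / 2)"

section \<open>Elementary bounds for the coefficients of the rescaled flow\<close>

lemma base: "t \<ge> T0 \<Longrightarrow> t + b0 \<ge> 1" using params by linarith

lemma a_pos: "t \<ge> T0 \<Longrightarrow> a t > 0" using rate_pos by (simp add: a_def)

lemma X': "t \<ge> T0 \<Longrightarrow> (X has_vector_derivative a t *\<^sub>R Q t) (at t within {T0..})"
  and Q': "t \<ge> T0 \<Longrightarrow> (Q has_vector_derivative
    a t *\<^sub>R (- 2 *\<^sub>R Q t - k *\<^sub>R L (X t) - b t *\<^sub>R G t (X t))) (at t within {T0..})"
  using X Q by (auto simp: a_def b_def)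

lemma b_bounds: assumes "t \<ge> T0" shows "b t > 0" "b t \<le> 1"
  using base[OF assms] params powr_mono[of m 0 "t + b0"] by (auto simp: b_def)

lemma b_deriv: "t \<ge> T0 \<Longrightarrow> (b has_real_derivative m * (t + b0) powr (m - 1)) (at t within S)"
  unfolding b_def using base[of t] by (auto intro!: derivative_eq_intros)

lemma \<eta>_deriv: "t \<ge> T0 \<Longrightarrow> (\<eta> has_real_derivative - b t) (at t within S)"
proof -
  assume t: "t \<ge> T0"
  have "((\<lambda>s. (s + b0) powr (m + 1) / (- (m + 1))) has_real_derivative
      ((m + 1) * (t + b0) powr m) / (- (m + 1))) (at t within S)"
    using base[OF t] by (intro DERIV_cdivide) (auto intro!: derivative_eq_intros)
  moreover have "((m + 1) * (t + b0) powr m) / (- (m + 1)) = - b t"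
    using params unfolding b_def by (simp add: divide_simps) (simp add: algebra_simps)
  ultimately show ?thesis unfolding \<eta>_def by simp
qed

lemma \<eta>_nonneg: "t \<ge> T0 \<Longrightarrow> \<eta> t \<ge> 0"
  unfolding \<eta>_def using params by auto

lemma \<phi>_deriv: "t \<ge> T0 \<Longrightarrow>
   (\<phi> has_real_derivative - ((t + b0) powr (- 3 / 2) / 2)) (at t within S)"
  unfolding \<phi>_def using base[of t] by (auto intro!: derivative_eq_intros)

text \<open>The second summand is the derivative of \<open>b\<close>, so this is the design identity
  \<open>a b - b' = \<sigma>\<close>.\<close>

lemma ab: "t \<ge> T0 \<Longrightarrow> a t * b t = \<sigma> + m * (t + b0) powr (m - 1)"
  unfolding a_def b_def using base[of t]
  by (simp add: distrib_right mult.assoc powr_diff flip: powr_add)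

text \<open>As \<open>m\<close> is negative, the product increases from its initial value towards
  \<open>\<sigma>\<close>. The lower bound later trades \<open>a\<close> for a power of
  \<open>t + b0\<close>.\<close>

lemma ab_bounds: assumes "t \<ge> T0" shows "a t * b t > 0" "a t * b t \<le> \<sigma>" "a t * b t \<ge> a T0 * b T0"
proof -
  show "a t * b t > 0" using a_pos b_bounds assms by simp
  show "a t * b t \<le> \<sigma>" using assms params by (simp add: ab mult_nonpos_nonneg)
  have "(t + b0) powr (m - 1) \<le> (T0 + b0) powr (m - 1)"
    using assms params by (intro powr_mono2') auto
  then show "a t * b t \<ge> a T0 * b T0" using assms params by (simp add: ab)
qed

section \<open>The Lyapunov function of the full flow\<close>

lemma C_nonneg: "C \<ge> 0" using d\<Phi>[of T0 0] by linarith

text \<open>The offset \<open>\<rho>\<close> makes the cost bracket nonnegative for admissible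
  \<open>c\<close>. The coefficient \<open>2 * C\<close> pays for the time derivative of the cost at
  the two points \<open>X t\<close> and \<open>c\<close>.\<close>

definition V :: "'e \<Rightarrow> real \<Rightarrow> real" where
  "V c t = energy L k (X t - c) (Q t) + b t * (\<Phi> t (X t) - \<Phi> t c + \<rho>) + 2 * C * \<eta> t"

definition V' :: "'e \<Rightarrow> real \<Rightarrow> real" where
  "V' c t = - a t * ((norm (Q t))\<^sup>2 + k * ((X t - c) \<bullet> L (X t - c)) + (X t - c + Q t) \<bullet> (b t *\<^sub>R G t (X t)))
     + (m * (t + b0) powr (m - 1) * (\<Phi> t (X t) - \<Phi> t c + \<rho>)
       + (d\<Phi> t (X t) + G t (X t) \<bullet> (a t *\<^sub>R Q t) - d\<Phi> t c) * b t) - 2 * C * b t"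

lemma V_has_derivative:
  assumes "t \<ge> T0" "c \<in> K"
  shows "(V c has_real_derivative V' c t) (at t within {T0..})"
proof -
  have Xc: "((\<lambda>s. X s - c) has_vector_derivative a t *\<^sub>R Q t) (at t within {T0..})"
    using X'[OF assms(1)] by (auto intro!: derivative_eq_intros)
  have LX: "L (X t - c) = L (X t)" using K(2)[OF assms(2)] L(1) by (simp add: linear_diff)
  have e: "((\<lambda>s. energy L k (X s - c) (Q s)) has_real_derivative
     - a t * ((norm (Q t))\<^sup>2 + k * ((X t - c) \<bullet> L (X t - c)) + (X t - c + Q t) \<bullet> (b t *\<^sub>R G t (X t)))) (at t within {T0..})"
    by (rule energy_has_derivative[where L = L and y = "\<lambda>s. X s - c" and p = Q and t = t and a = "a t", OF L(1) L(2) Xc]) (use Q'[OF assms(1)] LX in simp)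
  have c: "((\<lambda>s. \<Phi> s c) has_real_derivative d\<Phi> t c) (at t within {T0..})"
    using chain[OF assms(1), of "\<lambda>_. c" 0] by simp
  note x = chain[OF assms(1) X'[OF assms(1)]]
  show ?thesis unfolding V_def V'_def
    by (rule derivative_eq_intros e c x b_deriv \<eta>_deriv assms refl | simp)+
qed

lemma V_nonneg: assumes "t \<ge> T0" "c \<in> K" 
  shows "energy L k (X t - c) (Q t) \<le> V c t" "V c t \<ge> 0"
proof -
  show "energy L k (X t - c) (Q t) \<le> V c t"
    using K(3)[OF assms(2,1), of "X t"] b_bounds[OF assms(1)] \<eta>_nonneg[OF assms(1)] C_nonneg
    by (simp add: V_def)
  then show "V c t \<ge> 0" using energy_bounds(3)[of "X t - c" L k "Q t"] L(3) params by auto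
qed

text \<open>The term \<open>a b (Q \<bullet> G)\<close> produced by the cost cancels the same term
  of the energy, and \<open>\<eta>\<close> absorbs the explicit time derivatives.\<close>

lemma V'_le: assumes "t \<ge> T0" "c \<in> K"
  shows "V' c t \<le> - k * a t * (X t \<bullet> L (X t)) - a t * b t * ((X t - c) \<bullet> G t (X t))
           + m * (t + b0) powr (m - 1) * (\<Phi> t (X t) - \<Phi> t c + \<rho>)"
proof -
  have Lc: "L c = 0" using K(2)[OF assms(2)] .
  have LX: "(X t - c) \<bullet> L (X t - c) = X t \<bullet> L (X t)" 
    using Lc L(1) L(2)[of c "X t"] by (simp add: linear_diff inner_diff_left)
  have "(d\<Phi> t (X t) - d\<Phi> t c) * b t \<le> (2 * C) * b t"
    using d\<Phi>[OF assms(1), of "X t"] d\<Phi>[OF assms(1), of c] b_bounds[OF assms(1)]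
    by (intro mult_right_mono) auto
  moreover have "a t * (norm (Q t))\<^sup>2 \<ge> 0" using a_pos[OF assms(1)] by simp
  ultimately show ?thesis unfolding V'_def LX
    by (simp add: algebra_simps inner_add_left inner_diff_left inner_commute)
qed

text \<open>Convexity replaces the gradient term by the cost gap with factor \<open>- a b\<close>.
  Adding the contribution of \<open>b'\<close> leaves the factor \<open>- \<sigma>\<close>, and the
  remaining \<open>b' \<rho>\<close> is nonpositive.\<close>

lemma V'_le_value: assumes "t \<ge> T0" "c \<in> K"
  shows "V' c t \<le> - (\<sigma> * (\<Phi> t (X t) - \<Phi> t c) + k * a t * (X t \<bullet> L (X t)))"
proof -
  have "\<Phi> t (X t) - \<Phi> t c \<le> (X t - c) \<bullet> G t (X t)"
    using convex[OF assms(1), where y = "X t" and z = c] by (simp add: algebra_simps inner_commute)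
  then have "a t * b t * (\<Phi> t (X t) - \<Phi> t c) \<le> a t * b t * ((X t - c) \<bullet> G t (X t))"
    using ab_bounds[OF assms(1)] by (intro mult_left_mono) auto
  moreover have "\<rho> \<ge> 0" using K(3)[OF assms(2,1), of c] by simp
  then have "m * (t + b0) powr (m - 1) * \<rho> \<le> 0" using params by (simp add: mult_nonpos_nonneg)
  ultimately show ?thesis using V'_le[OF assms] unfolding ab[OF assms(1)]
    by (simp add: algebra_simps)
qed

text \<open>With comparator 0 the gradient term is \<open>X \<bullet> G\<close>, which dominates the
  norm of the gradient up to \<open>M\<close>; the other terms have a favourable sign.\<close>

lemma V'_le_gradient: assumes "t \<ge> T0"
  shows "V' 0 t \<le> - (a t * b t * norm (G t (X t))) + \<sigma> * M"
proof -
  have M: "M \<ge> 0" using coercive_grad[OF assms, of 0] norm_ge_zero[of "G t 0"] by (simp del: norm_ge_zero)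
  have "a t * b t * norm (G t (X t)) \<le> a t * b t * (X t \<bullet> G t (X t) + M)"
    using ab_bounds[OF assms] coercive_grad[OF assms] by (intro mult_left_mono) auto
  moreover have "a t * b t * M \<le> \<sigma> * M" using ab_bounds[OF assms] M by (intro mult_right_mono) auto
  moreover have "m * (t + b0) powr (m - 1) * (\<Phi> t (X t) - \<Phi> t 0 + \<rho>) \<le> 0"
    using K(3)[OF K(1) assms, of "X t"] params by (intro mult_nonpos_nonneg) (auto simp: mult_nonpos_nonneg)
  moreover have "k * a t * (X t \<bullet> L (X t)) \<ge> 0" using params a_pos[OF assms] L(3)[of "X t"] by simp
  ultimately show ?thesis using V'_le[OF assms K(1)] by (simp add: algebra_simps)
qed

section \<open>Integrated Lyapunov estimates along the trajectory\<close>

lemma continuous_X: "continuous_on {T0..} X"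
  using X' by (intro continuous_on_vector_derivative) (auto)

lemma continuous_a: "continuous_on {T0..} a"
  unfolding a_def using base by (intro continuous_intros) force+

lemma continuous_\<Phi>: "continuous_on {T0..} (\<lambda>t. \<Phi> t (X t))" "continuous_on {T0..} (\<lambda>t. \<Phi> t c)"
proof -
  show "continuous_on {T0..} (\<lambda>t. \<Phi> t (X t))"
    using chain[OF _ X'] by (intro DERIV_continuous_on) auto
  show "continuous_on {T0..} (\<lambda>t. \<Phi> t c)"
    using chain[of _ "\<lambda>_. c" 0] by (intro DERIV_continuous_on) auto
qed

lemma continuous_LX: "continuous_on {T0..} (\<lambda>t. L (X t))" 
  using L(1) linear_continuous_on[of L UNIV] continuous_X
  by (metis continuous_on_compose2 linear_conv_bounded_linear subset_UNIV)

lemma value_bound: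
  assumes "T \<ge> T0" "c \<in> K"
  shows "\<sigma> * integral {T0..T} (\<lambda>t. \<Phi> t (X t) - \<Phi> t c)
         + k * integral {T0..T} (\<lambda>t. a t * (X t \<bullet> L (X t))) \<le> V c T0"
proof -
  have sub: "{T0..T} \<subseteq> {T0..}" by auto
  have 1: "(\<lambda>t. \<Phi> t (X t) - \<Phi> t c) integrable_on {T0..T}"
    by (intro integrable_continuous_real continuous_intros continuous_on_subset[OF continuous_\<Phi>(1) sub]
        continuous_on_subset[OF continuous_\<Phi>(2) sub])
  have 2: "(\<lambda>t. a t * (X t \<bullet> L (X t))) integrable_on {T0..T}"
    by (intro integrable_continuous_real continuous_intros continuous_on_subset[OF continuous_a sub]
        continuous_on_subset[OF continuous_X sub] continuous_on_subset[OF continuous_LX sub])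
  have "integral {T0..T} (\<lambda>t. \<sigma> * (\<Phi> t (X t) - \<Phi> t c) + k * (a t * (X t \<bullet> L (X t)))) \<le> V c T0 - V c T"
    using 1 2 by (intro integral_le_lyapunov_decrease[where \<Psi>'="V' c", OF assms(1) V_has_derivative[OF _ assms(2)]])
      (auto intro!: integrable_add integrable_on_mult_right order_trans[OF V'_le_value[OF _ assms(2)]] simp: mult.assoc)
  moreover have "integral {T0..T} (\<lambda>t. \<sigma> * (\<Phi> t (X t) - \<Phi> t c) + k * (a t * (X t \<bullet> L (X t))))
    = \<sigma> * integral {T0..T} (\<lambda>t. \<Phi> t (X t) - \<Phi> t c) + k * integral {T0..T} (\<lambda>t. a t * (X t \<bullet> L (X t)))"
    using 1 2 by (simp add: integral_add integrable_on_mult_right)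
  ultimately show ?thesis using V_nonneg(2)[OF assms] by linarith
qed

text \<open>The cost gap to the origin is at least \<open>- \<rho>\<close>, so \<open>V 0\<close>
  grows at most linearly and the state at most like a square root of time.\<close>

lemma growth:
  assumes "t \<ge> T0"
  shows "(norm (X t))\<^sup>2 \<le> 2 * (V 0 T0 + \<sigma> * \<rho> * (t - T0))"
proof -
  have "integral {T0..t} (\<lambda>_. - \<sigma> * \<rho>) \<le> V 0 T0 - V 0 t"
  proof (rule integral_le_lyapunov_decrease[where \<Psi>'="V' 0", OF assms V_has_derivative[OF _ K(1)]])
    fix s assume s: "s \<ge> T0"
    have "\<sigma> * (\<Phi> s (X s) - \<Phi> s 0) \<ge> \<sigma> * (- \<rho>)"
      using K(3)[OF K(1) s, of "X s"] params by (intro mult_left_mono) auto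
    moreover have "k * a s * (X s \<bullet> L (X s)) \<ge> 0" using params a_pos[OF s] L(3)[of "X s"] by simp
    ultimately show "V' 0 s \<le> - (- \<sigma> * \<rho>)" using V'_le_value[OF s K(1)] by simp
  qed auto
  moreover have "(norm (X t))\<^sup>2 \<le> 2 * energy L k (X t) (Q t)"
    using energy_bounds(1)[of "X t" L k "Q t"] L(3) params by simp
  ultimately show ?thesis using V_nonneg(1)[OF assms K(1)] assms by (simp add: algebra_simps)
qed

section \<open>Decay of the disagreement between the agents\<close>

text \<open>The summand \<open>b\<^sup>2\<close> keeps the square root differentiable; it costs only the bounded
  quantity \<open>a b \<le> \<sigma>\<close> in the decay estimate.\<close>

definition U :: "real \<Rightarrow> real" where
  "U t = sqrt (energy L k (P (X t)) (P (Q t)) + (b t)\<^sup>2)"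

definition \<kappa> :: real where "\<kappa> = 1 / (1 + 2 * \<Lambda> / k + 1)"

text \<open>The dissipation controls \<open>p\<close> and the quadratic form directly, and through
  the Poincare inequality also \<open>P y\<close>. The reciprocal of \<open>\<kappa>\<close>
  collects the constants of these bounds.\<close>

lemma energy_le_dissipation:
  "\<kappa> * energy L k (P y) p \<le> (norm p)\<^sup>2 + k * (y \<bullet> L y)"
proof -
  have pos: "1 + 2 * \<Lambda> / k + 1 > 0" using coercive params by (simp add: add_pos_pos)
  have PL: "P y \<bullet> L (P y) = y \<bullet> L y" by (metis L(2) P(4))
  have n: "(norm (P y + p))\<^sup>2 \<le> 2 * (norm (P y))\<^sup>2 + 2 * (norm p)\<^sup>2"
    using sum_squares_bound[of "norm (P y)" "norm p"]
      power_mono[OF norm_triangle_ineq[of "P y" p], of 2]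
    by (simp add: power2_sum)
  have "energy L k (P y) p \<le> 2 * (norm (P y))\<^sup>2 + (norm p)\<^sup>2 + k * (y \<bullet> L y)"
    using n mult_nonneg_nonneg[OF less_imp_le[OF params(5)] L(3)[of y]] zero_le_power2[of "norm (P y)"]
    unfolding energy_def PL by linarith
  also have "\<dots> \<le> 2 * \<Lambda> / k * (k * (y \<bullet> L y)) + (norm p)\<^sup>2 + k * (y \<bullet> L y)"
    using coercive(2)[of y] params by simp
  also have "\<dots> \<le> (1 + 2 * \<Lambda> / k + 1) * ((norm p)\<^sup>2 + k * (y \<bullet> L y))"
  proof -
    have "2 * \<Lambda> / k \<ge> 0" "k * (y \<bullet> L y) \<ge> 0" using params coercive(1) L(3)[of y] by auto
    then have "2 * \<Lambda> / k * (norm p)\<^sup>2 \<ge> 0" "k * (y \<bullet> L y) \<ge> 0" by (simp_all only: zero_le_power2 mult_nonneg_nonneg)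
    then show ?thesis using zero_le_power2[of "norm p"] unfolding distrib_left distrib_right by linarith
  qed
  finally show ?thesis using pos unfolding \<kappa>_def by (simp add: field_simps)
qed

lemma \<kappa>_pos: "\<kappa> > 0"
  unfolding \<kappa>_def using coercive params by (simp add: add_pos_pos)

lemma U_bounds: assumes "t \<ge> T0"
  shows "U t > 0" "b t \<le> U t" "norm (P (X t)) \<le> 2 * U t" "norm (P (X t) + P (Q t)) \<le> 2 * U t"
    "(U t)\<^sup>2 = energy L k (P (X t)) (P (Q t)) + (b t)\<^sup>2"
proof -
  note e = energy_bounds[where L = L and p = "P (Q t)", OF L(3)[of "P (X t)"], of k]
  have b: "b t > 0" using b_bounds[OF assms] by simp
  show U2: "(U t)\<^sup>2 = energy L k (P (X t)) (P (Q t)) + (b t)\<^sup>2"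
    unfolding U_def using e(3) params by simp
  show bU: "b t \<le> U t" unfolding U_def using e(3) params b by (intro real_le_rsqrt) simp
  then show U: "U t > 0" using b by linarith
  have "energy L k (P (X t)) (P (Q t)) \<le> (U t)\<^sup>2" unfolding U2 by simp
  then have "(norm (P (X t)))\<^sup>2 \<le> (2 * U t)\<^sup>2" "(norm (P (X t) + P (Q t)))\<^sup>2 \<le> (2 * U t)\<^sup>2"
    using e(1,2) params(5) zero_le_power2[of "U t"] unfolding power_mult_distrib power2_eq_square[of 2]
    by linarith+
  then show "norm (P (X t)) \<le> 2 * U t" "norm (P (X t) + P (Q t)) \<le> 2 * U t"
    using U by (auto intro: power2_le_imp_le[where y = "2 * U t"] simp del: power_mult_distrib)
qed

definition U' :: "real \<Rightarrow> real" where
  "U' t = (- a t * ((norm (P (Q t)))\<^sup>2 + k * (P (X t) \<bullet> L (P (X t)))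
      + (P (X t) + P (Q t)) \<bullet> (b t *\<^sub>R P (G t (X t))))
    + 2 * (m * (t + b0) powr (m - 1)) * b t) / (2 * U t)"

lemma U_has_derivative:
  assumes "t \<ge> T0"
  shows "(U has_real_derivative U' t) (at t within {T0..})"
proof -
  have bP: "bounded_linear P" using P(1) by (simp add: linear_conv_bounded_linear)
  have y: "((\<lambda>s. P (X s)) has_vector_derivative a t *\<^sub>R P (Q t)) (at t within {T0..})"
    using bounded_linear.has_vector_derivative[OF bP X'[OF assms]] P(1) by (simp add: linear_scale)
  have p: "((\<lambda>s. P (Q s)) has_vector_derivative
      a t *\<^sub>R (- 2 *\<^sub>R P (Q t) - k *\<^sub>R L (P (X t)) - b t *\<^sub>R P (G t (X t)))) (at t within {T0..})"
    using bounded_linear.has_vector_derivative[OF bP Q'[OF assms]] P(1)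
    by (simp add: linear_scale linear_diff linear_neg P(4,5))
  note e = energy_has_derivative[where L = L and y = "\<lambda>s. P (X s)" and p = "\<lambda>s. P (Q s)" and t = t and a = "a t", OF L(1) L(2) y p]
  have "U t > 0" using U_bounds[OF assms] by simp
  then have pos: "energy L k (P (X t)) (P (Q t)) + (b t)\<^sup>2 > 0" by (simp add: U_def)
  have b2: "((\<lambda>s. (b s)\<^sup>2) has_real_derivative 2 * (m * (t + b0) powr (m - 1)) * b t) (at t within {T0..})"
    using DERIV_power[OF b_deriv[OF assms], of 2 "{T0..}"] by (simp add: mult.assoc)
  have D: "((\<lambda>s. energy L k (P (X s)) (P (Q s)) + (b s)\<^sup>2) has_real_derivative
    - a t * ((norm (P (Q t)))\<^sup>2 + k * (P (X t) \<bullet> L (P (X t)))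
      + (P (X t) + P (Q t)) \<bullet> (b t *\<^sub>R P (G t (X t))))
    + 2 * (m * (t + b0) powr (m - 1)) * b t) (at t within {T0..})"
    by (rule DERIV_add[OF e b2])
  have gen: "inverse s / 2 * N = N / (2 * s)" for s N :: real
    by (cases "s = 0") (simp_all add: field_simps)
  have "((\<lambda>s. sqrt (energy L k (P (X s)) (P (Q s)) + (b s)\<^sup>2)) has_real_derivative U' t) (at t within {T0..})"
    by (rule DERIV_cong[OF DERIV_chain2[OF DERIV_real_sqrt[OF pos] D]]) (unfold U'_def U_def, rule gen)
  moreover have "U = (\<lambda>s. sqrt (energy L k (P (X s)) (P (Q s)) + (b s)\<^sup>2))"
    by (simp add: U_def fun_eq_iff)
  ultimately show ?thesis by simp
qed

text \<open>Passing to the square root of the energy makes the forcing enter linearly, as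
  \<open>a b\<close> times the norm of the gradient. This is exactly the quantity that
  \<open>V 0\<close> dissipates.\<close>

lemma U'_le:
  assumes "t \<ge> T0"
  shows "U' t \<le> - (\<kappa> / 2 * a t * U t) + \<kappa> * \<sigma> / 2 + a t * b t * norm (G t (X t))"
proof -
  let ?y = "P (X t)" and ?p = "P (Q t)" and ?g = "G t (X t)"
  note U = U_bounds[OF assms]
  have a: "a t > 0" and b: "b t > 0" using a_pos b_bounds assms by auto
  have "- ((?y + ?p) \<bullet> P ?g) = - ((?y + ?p) \<bullet> ?g)"
    using P(2)[of "?y + ?p" ?g] P(1,3) by (simp add: linear_add)
  also have "\<dots> \<le> norm (?y + ?p) * norm ?g"
    using Cauchy_Schwarz_ineq2[of "?y + ?p" ?g] by linarith
  also have "\<dots> \<le> 2 * U t * norm ?g" using U by (intro mult_right_mono) auto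
  finally have "b t * - ((?y + ?p) \<bullet> P ?g) \<le> b t * (2 * U t * norm ?g)"
    using b by (intro mult_left_mono) auto
  moreover have "\<kappa> * ((U t)\<^sup>2 - (b t)\<^sup>2) \<le> (norm ?p)\<^sup>2 + k * (?y \<bullet> L ?y)"
    using energy_le_dissipation[of "?y" "?p"] U(5) P(3) by simp
  ultimately have "a t * (- ((norm ?p)\<^sup>2 + k * (?y \<bullet> L ?y)) + b t * - ((?y + ?p) \<bullet> P ?g))
     \<le> a t * (- (\<kappa> * ((U t)\<^sup>2 - (b t)\<^sup>2)) + b t * (2 * U t * norm ?g))"
    using a by (intro mult_left_mono) auto
  moreover have "2 * (m * (t + b0) powr (m - 1)) * b t \<le> 0"
    using params b by (simp add: mult_nonpos_nonneg)
  ultimately have "U' t \<le> a t * (- (\<kappa> * ((U t)\<^sup>2 - (b t)\<^sup>2)) + b t * (2 * U t * norm ?g)) / (2 * U t)"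
    unfolding U'_def using U(1) by (intro divide_right_mono) (auto simp: algebra_simps)
  also have "\<dots> = - (\<kappa> / 2 * a t * U t) + \<kappa> / 2 * (a t * b t) * (b t / U t) + a t * b t * norm ?g"
    using U(1) by (simp add: field_simps power2_eq_square)
  also have "\<kappa> / 2 * (a t * b t) * (b t / U t) \<le> \<kappa> / 2 * \<sigma> * 1"
    using U(1,2) ab_bounds[OF assms] \<kappa>_pos b params by (intro mult_mono) auto
  finally show ?thesis by simp
qed

text \<open>In \<open>V 0 + U\<close> the gradient terms cancel exactly, leaving decay proportional
  to \<open>a U\<close> and a constant rate. Multiplication by the decreasing weight
  \<open>\<phi>\<close> preserves the decay and makes the constant rate integrate to a square
  root.\<close>

lemma disagreement_bound:
  assumes "T \<ge> T0"
  shows "(\<lambda>t. \<phi> t * a t * norm (P (X t))) integrable_on {T0..T}"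
    "integral {T0..T} (\<lambda>t. \<phi> t * a t * norm (P (X t)))
      \<le> 4 / \<kappa> * (\<phi> T0 * (V 0 T0 + U T0)) + 4 / \<kappa> * (\<kappa> * \<sigma> + 2 * \<sigma> * M) * sqrt (T - T0)"
proof -
  \<comment> \<open>The constant rates lost by \<open>U\<close> and by \<open>V 0\<close>, in this
    order.\<close>
  define D where "D = \<kappa> * \<sigma> / 2 + \<sigma> * M"
  have M: "M \<ge> 0" using coercive_grad[of T0 0] norm_ge_zero[of "G T0 0"] by (simp del: norm_ge_zero)
  have D: "D \<ge> 0" using \<kappa>_pos params M by (simp add: D_def)
  \<comment> \<open>The subtracted term has derivative \<open>D * \<phi> t\<close> and compensates
    the constant rate.\<close>
  define \<Psi> where "\<Psi> t = \<phi> t * (V 0 t + U t) - 2 * D * (t + b0) powr (1/2)" for t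
  define \<Psi>' where "\<Psi>' t = - ((t + b0) powr (- 3 / 2) / 2) * (V 0 t + U t)
     + (V' 0 t + U' t) * \<phi> t - 2 * D * (1/2 * (t + b0) powr (1/2 - 1))" for t
  have \<Psi>: "(\<Psi> has_real_derivative \<Psi>' t) (at t within {T0..})" if "t \<ge> T0" for t
  proof -
    have "((\<lambda>s. (s + b0) powr (1/2)) has_real_derivative 1/2 * (t + b0) powr (1/2 - 1)) (at t within {T0..})"
      using base[OF that] by (auto intro!: derivative_eq_intros)
    then show ?thesis unfolding \<Psi>_def \<Psi>'_def
      by (intro DERIV_diff DERIV_mult DERIV_add DERIV_cmult \<phi>_deriv V_has_derivative U_has_derivative K(1) that)
  qed
  have le: "\<Psi>' t \<le> - (\<kappa> / 4 * (\<phi> t * a t * norm (P (X t))))" if t: "t \<ge> T0" for t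
  proof -
    have \<phi>: "\<phi> t \<ge> 0" by (simp add: \<phi>_def)
    have "V' 0 t + U' t \<le> - (\<kappa> / 2 * a t * U t) + D"
      using V'_le_gradient[OF t] U'_le[OF t] by (simp add: D_def)
    moreover have "\<kappa> / 2 * a t * U t \<ge> \<kappa> / 2 * a t * (norm (P (X t)) / 2)"
      using U_bounds(3)[OF t] \<kappa>_pos a_pos[OF t] by (intro mult_left_mono) auto
    ultimately have "V' 0 t + U' t \<le> - (\<kappa> / 2 * a t * (norm (P (X t)) / 2)) + D" by linarith
    then have "(V' 0 t + U' t) * \<phi> t \<le> (- (\<kappa> / 2 * a t * (norm (P (X t)) / 2)) + D) * \<phi> t"
      using \<phi> by (intro mult_right_mono) auto
    moreover have "(t + b0) powr (- 3 / 2) / 2 * (V 0 t + U t) \<ge> 0"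
      using V_nonneg(2)[OF t K(1)] U_bounds(1)[OF t] by simp
    moreover have "(t + b0) powr (1/2 - 1) = \<phi> t" by (simp add: \<phi>_def)
    ultimately show ?thesis unfolding \<Psi>'_def by (simp add: algebra_simps)
  qed
  have c\<phi>: "continuous_on {T0..} \<phi>"
    unfolding \<phi>_def using base by (intro continuous_intros) force+
  have cP: "continuous_on {T0..} (\<lambda>t. P (X t))"
    using P(1) linear_continuous_on[of P UNIV] continuous_X
    by (metis continuous_on_compose2 linear_conv_bounded_linear subset_UNIV)
  have "continuous_on {T0..T} (\<lambda>t. \<phi> t * a t * norm (P (X t)))"
    by (rule continuous_on_subset[of "{T0..}"]) (auto intro!: continuous_intros c\<phi> continuous_a cP)
  then show int: "(\<lambda>t. \<phi> t * a t * norm (P (X t))) integrable_on {T0..T}"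
    by (rule integrable_continuous_real)
  have "integral {T0..T} (\<lambda>t. \<kappa> / 4 * (\<phi> t * a t * norm (P (X t)))) \<le> \<Psi> T0 - \<Psi> T"
    by (rule integral_le_lyapunov_decrease[where \<Psi>'=\<Psi>', OF assms \<Psi> le]) (auto intro: integrable_on_mult_right int)
  also have "\<dots> \<le> \<phi> T0 * (V 0 T0 + U T0) + 2 * D * sqrt (T - T0)"
  proof -
    \<comment> \<open>Subadditivity turns the difference of the two compensating square roots into
      \<open>sqrt (T - T0)\<close>.\<close>
    have "sqrt (T + b0) \<le> sqrt (T0 + b0) + sqrt (T - T0)"
      using sqrt_add_le_add_sqrt[of "T0 + b0" "T - T0"] assms params by (simp add: add.commute)
    then have "2 * D * sqrt (T + b0) \<le> 2 * D * (sqrt (T0 + b0) + sqrt (T - T0))"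
      using D by (intro mult_left_mono) auto
    moreover have "\<phi> T * (V 0 T + U T) \<ge> 0"
      using V_nonneg(2)[OF assms K(1)] U_bounds(1)[OF assms] by (simp add: \<phi>_def)
    ultimately show ?thesis unfolding \<Psi>_def using base[of T] base[of T0] assms
      by (simp add: powr_half_sqrt algebra_simps)
  qed
  finally have "\<kappa> / 4 * integral {T0..T} (\<lambda>t. \<phi> t * a t * norm (P (X t)))
      \<le> \<phi> T0 * (V 0 T0 + U T0) + 2 * D * sqrt (T - T0)" by simp
  then have "4 / \<kappa> * (\<kappa> / 4 * integral {T0..T} (\<lambda>t. \<phi> t * a t * norm (P (X t))))
      \<le> 4 / \<kappa> * (\<phi> T0 * (V 0 T0 + U T0) + 2 * D * sqrt (T - T0))"
    using \<kappa>_pos by (intro mult_left_mono) auto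
  also have "\<dots> = 4 / \<kappa> * (\<phi> T0 * (V 0 T0 + U T0)) + 4 / \<kappa> * (2 * D) * sqrt (T - T0)"
    unfolding distrib_left mult.assoc ..
  also have "2 * D = \<kappa> * \<sigma> + 2 * \<sigma> * M" by (simp add: D_def)
  finally show "integral {T0..T} (\<lambda>t. \<phi> t * a t * norm (P (X t)))
      \<le> 4 / \<kappa> * (\<phi> T0 * (V 0 T0 + U T0)) + 4 / \<kappa> * (\<kappa> * \<sigma> + 2 * \<sigma> * M) * sqrt (T - T0)"
    using \<kappa>_pos by simp
qed

text \<open>Multiplied by \<open>b\<close>, this compares the exponents \<open>m / 2\<close> and
  \<open>- 1 / 2\<close>, which is where \<open>m < - 1\<close> enters.\<close>

lemma weight_le_\<phi>_a:
  assumes "t \<ge> T0"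
  shows "a T0 * b T0 * (t + b0) powr (- m / 2) \<le> \<phi> t * a t"
proof -
  have c: "a T0 * b T0 > 0" using ab_bounds(1)[of T0] by simp
  have "(t + b0) powr (- m / 2) * b t \<le> \<phi> t"
    unfolding b_def \<phi>_def powr_add[symmetric] using base[OF assms] params by (intro powr_mono) auto
  then have "a T0 * b T0 * ((t + b0) powr (- m / 2) * b t) \<le> (a t * b t) * \<phi> t"
    by (rule mult_mono[OF ab_bounds(3)[OF assms]]) (use ab_bounds(1)[OF assms] b_bounds[OF assms] in auto)
  then have "(a T0 * b T0 * (t + b0) powr (- m / 2)) * b t \<le> (\<phi> t * a t) * b t"
    by (simp add: ac_simps)
  then show ?thesis using b_bounds[OF assms] by simp
qed

text \<open>The comparator changes with the horizon, so a constant independent of \<open>T\<close>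
  requires a bound on the initial value uniform in \<open>c\<close>.\<close>

lemma V_initial_bounded:
  assumes "\<And>c. c \<in> K \<Longrightarrow> norm c \<le> r"
  obtains W where "\<And>c. c \<in> K \<Longrightarrow> V c T0 \<le> W"
proof -
  let ?W = "(norm (X T0) + r + norm (Q T0))\<^sup>2 / 2 + (norm (X T0) + r)\<^sup>2 / 2 + k * (X T0 \<bullet> L (X T0)) / 2
    + b T0 * (\<Phi> T0 (X T0) - \<Phi> T0 0 + \<rho> + \<rho>) + 2 * C * \<eta> T0"
  have "V c T0 \<le> ?W" if c: "c \<in> K" for c
  proof -
    have LX: "(X T0 - c) \<bullet> L (X T0 - c) = X T0 \<bullet> L (X T0)"
      using K(2)[OF c] L(1) L(2)[of c "X T0"] by (simp add: linear_diff inner_diff_left)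
    have n: "norm (X T0 - c) \<le> norm (X T0) + r"
      using norm_triangle_ineq4[of "X T0" c] assms[OF c] by simp
    then have "norm (X T0 - c + Q T0) \<le> norm (X T0) + r + norm (Q T0)"
      using norm_triangle_ineq[of "X T0 - c" "Q T0"] by simp
    then have "(norm (X T0 - c + Q T0))\<^sup>2 \<le> (norm (X T0) + r + norm (Q T0))\<^sup>2"
      "(norm (X T0 - c))\<^sup>2 \<le> (norm (X T0) + r)\<^sup>2"
      using n by (auto intro: power_mono)
    \<comment> \<open>The second \<open>\<rho>\<close> arises from comparing \<open>c\<close> with
      the comparator 0.\<close>
    moreover have "b T0 * (\<Phi> T0 (X T0) - \<Phi> T0 c + \<rho>) \<le> b T0 * (\<Phi> T0 (X T0) - \<Phi> T0 0 + \<rho> + \<rho>)"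
      using K(3)[OF K(1), of T0 c] b_bounds[of T0] by (intro mult_left_mono) auto
    ultimately show ?thesis unfolding V_def energy_def LX by linarith
  qed
  then show ?thesis by (rule that)
qed

lemma dissipation_integral_nonneg: "integral {T0..T} (\<lambda>t. a t * (X t \<bullet> L (X t))) \<ge> 0"
proof (rule Henstock_Kurzweil_Integration.integral_nonneg)
  have "continuous_on {T0..} (\<lambda>t. a t * (X t \<bullet> L (X t)))"
    by (intro continuous_intros continuous_a continuous_X continuous_LX)
  then show "(\<lambda>t. a t * (X t \<bullet> L (X t))) integrable_on {T0..T}"
    by (intro integrable_continuous_real) (auto intro: continuous_on_subset)
  show "a t * (X t \<bullet> L (X t)) \<ge> 0" if "t \<in> {T0..T}" for t
    using a_pos[of t] L(3)[of "X t"] that by simp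
qed

end

subsection \<open>Regret\<close>

lemma minimizerD: "minimizer g x \<Longrightarrow> g x \<le> g y"
  unfolding minimizer_def is_arg_min_def by (meson linorder_not_less)

lemma block_kron_vec_1: "block (kron_vec 1 c) i = c"
  by (simp add: block_def kron_vec_def vec_eq_iff)

lemma block_stack: "block (stack z) i = z i"
  by (simp add: block_def stack_def vec_eq_iff)

theorem theorem4:
  fixes f :: "'N::finite \<Rightarrow> real \<Rightarrow> real ^ 'n \<Rightarrow> real"
    and E :: "('N \<times> 'N) set" and A :: "real ^ 'N ^ 'N"
    and xt :: "real \<Rightarrow> real ^ 'n"
    and x v acc :: "'N \<Rightarrow> real \<Rightarrow> real ^ 'n"
    and \<alpha> \<beta> :: "real \<Rightarrow> real"
    and T0 w_min m0 k1 \<sigma> m b0 :: real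
  assumes T0: "T0 \<ge> 0"
    and f_C1: "\<And>i. C1_on ({T0..} \<times> UNIV) (\<lambda>(t, y). f i t y)"
    and f_convex: "\<And>i t. t \<ge> T0 \<Longrightarrow> convex_on UNIV (f i t)"
    and f_smooth: "\<And>i y. smooth_on {T0..} (\<lambda>t. f i t y)"
    and graph: "connected_weighted_graph E A"
    and w_min: "minimal_edge_weight E A w_min"
    and B1: "\<exists>c0>0. \<forall>t\<ge>T0. \<exists>xs. minimizer (sum_cost f t) xs \<and> norm xs \<le> c0"
    and B2_min: "\<And>T. T > T0 \<Longrightarrow> minimizer (\<lambda>y. integral {T0..T} (\<lambda>t. sum_cost f t y)) (xt T)"
    and B2_bounded: "\<exists>c. \<forall>T>T0. norm (xt T) \<le> c"
    and B3: "\<exists>c>0. \<forall>i. \<forall>t\<ge>T0. \<exists>xd. minimizer (f i t) xd \<and> norm xd \<le> c"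
    and B4: "\<forall>R>0. \<exists>M>0. \<forall>y t i. norm y \<le> R \<longrightarrow> t \<ge> T0 \<longrightarrow> \<bar>f i t y\<bar> \<le> M"
    and B5: "\<exists>C. \<forall>t\<ge>T0. \<forall>y.
               \<bar>vector_derivative (\<lambda>s. stacked_cost f s y) (at t within {T0..})\<bar> \<le> C"
    and B6: "\<forall>a1>0. \<forall>b1>0. \<exists>a2>0. \<exists>b2>0. gradient_growth f T0 m0 a1 b1 a2 b2"
    and k1: "k1 > 0" and \<sigma>: "\<sigma> > 0"
    and m: "m < - 1" "m \<le> - 2 * m0"
    and b0: "b0 \<ge> 1" "b0 > (- m / \<sigma>) powr (1 / (1 - m))"
    and \<beta>: "\<And>t. t \<ge> T0 \<Longrightarrow> exp (\<beta> t) = (t + b0) powr m"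
    and \<alpha>: "\<And>t. t \<ge> T0 \<Longrightarrow> exp (\<alpha> t) = m * (t + b0) powr (- 1) + \<sigma> * (t + b0) powr (- m)"
    and vel: "\<And>i t. t \<ge> T0 \<Longrightarrow> (x i has_vector_derivative v i t) (at t within {T0..})"
    and acc: "\<And>i t. t \<ge> T0 \<Longrightarrow> (v i has_vector_derivative acc i t) (at t within {T0..})"
    and ode: "\<And>i t. t \<ge> T0 \<Longrightarrow>
        acc i t
        + (2 * exp (\<alpha> t) - vector_derivative \<alpha> (at t within {T0..})) *\<^sub>R v i t
        + exp (2 * \<alpha> t + \<beta> t) *\<^sub>R gradient (f i t) (x i t)
        + (\<Sum>j\<in>UNIV. (A $ i $ j * k1 * exp (2 * \<alpha> t)) *\<^sub>R (x i t - x j t)) = 0"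
  shows "\<exists>\<rho>>0. \<exists>\<omega>>0. \<exists>a2>0. \<exists>b2>0.
      (\<exists>a1>0. \<exists>b1>0. gradient_growth f T0 m0 a1 b1 a2 b2) \<and>
      (\<forall>i. \<forall>t>T0. norm (gradient (f i t) (x i t)) \<le> a2 * t powr m0 + b2) \<and>
      (\<forall>T>T0.
        (\<forall>y. \<forall>t\<in>{T0..T}. stacked_cost f t y - stacked_cost f t (kron_vec 1 (xt T)) \<ge> - \<rho>) \<and>
        integral {T0..T}
          (\<lambda>t. exp (\<alpha> t) * (stack (\<lambda>i. x i t) \<bullet> (kron (laplacian A) (mat 1) *v stack (\<lambda>i. x i t)))
                - \<sigma> * \<rho> / k1) \<le> \<omega> / k1 \<and>
        (let N = real CARD('N);
             \<epsilon>1 = \<sigma> * \<rho> / k1 * (T - T0) + \<omega> / k1;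
             \<epsilon>2 = \<rho> / (k1 * b0 powr (- m)) * (T - T0) + \<omega> / (k1 * \<sigma> * b0 powr (- m))
         in static_regret f T0 x xt T
              \<le> \<omega> / \<sigma>
                + N * a2 / sqrt \<sigma> * sqrt (N / w_min * \<epsilon>1)
                + N * b2 * sqrt (N / w_min * \<epsilon>2)))"
proof -
  let ?A = "\<lambda>t. m * (t + b0) powr (- 1) + \<sigma> * (t + b0) powr (- m)"
  let ?N = "real CARD('N)"
  define X where "X t = (\<chi> i. x i t)" for t
  define Q where "Q t = (\<chi> i. exp (- \<alpha> t) *\<^sub>R v i t)" for t
  define \<Phi> where "\<Phi> t y = (\<Sum>i\<in>UNIV. f i t (y $ i))" for t and y :: "(real ^ 'n) ^ 'N"
  define G where "G t y = (\<chi> i. gradient (f i t) (y $ i))" for t and y :: "(real ^ 'n) ^ 'N"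

  \<comment> \<open>Uniform bounds and derivatives of the local costs\<close>
  have sym: "transpose A = A" using graph by (simp add: connected_weighted_graph_def)
  obtain \<Lambda> where \<Lambda>: "\<Lambda> > 0" "\<And>y :: (real ^ 'n) ^ 'N. (norm (center y))\<^sup>2 \<le> \<Lambda> * (y \<bullet> lap_op A y)"
    "\<And>y :: (real ^ 'n) ^ 'N. y \<bullet> lap_op A y \<ge> 0"
    using connected_graph_coercive[OF graph] by blast

  have "\<forall>i. \<exists>d. (\<forall>t\<ge>T0. \<forall>y. GDERIV (f i t) y :> gradient (f i t) y) \<and>
    (\<forall>t z z'. t \<ge> T0 \<longrightarrow> (z has_vector_derivative z') (at t within {T0..}) \<longrightarrow>
      ((\<lambda>s. f i s (z s)) has_real_derivative d t (z t) + gradient (f i t) (z t) \<bullet> z') (at t within {T0..}))"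
  proof
    fix i
    obtain d where "\<And>t y. t \<ge> T0 \<Longrightarrow> GDERIV (f i t) y :> gradient (f i t) y"
      "\<And>t z z'. t \<ge> T0 \<Longrightarrow> (z has_vector_derivative z') (at t within {T0..}) \<Longrightarrow>
      ((\<lambda>s. f i s (z s)) has_real_derivative d t (z t) + gradient (f i t) (z t) \<bullet> z') (at t within {T0..})"
      using C1_on_chain[OF f_C1[of i]] by metis
    then show "\<exists>d. (\<forall>t\<ge>T0. \<forall>y. GDERIV (f i t) y :> gradient (f i t) y) \<and>
    (\<forall>t z z'. t \<ge> T0 \<longrightarrow> (z has_vector_derivative z') (at t within {T0..}) \<longrightarrow>
      ((\<lambda>s. f i s (z s)) has_real_derivative d t (z t) + gradient (f i t) (z t) \<bullet> z') (at t within {T0..}))"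
      by blast
  qed
  from choice[OF this] obtain d where grad: "\<And>i t y. t \<ge> T0 \<Longrightarrow> GDERIV (f i t) y :> gradient (f i t) y"
    and f_chain: "\<And>i t z z'. t \<ge> T0 \<Longrightarrow> (z has_vector_derivative z') (at t within {T0..}) \<Longrightarrow>
      ((\<lambda>s. f i s (z s)) has_real_derivative d i t (z t) + gradient (f i t) (z t) \<bullet> z') (at t within {T0..})"
    by metis
  define d\<Phi> where "d\<Phi> t y = (\<Sum>i\<in>UNIV. d i t (y $ i))" for t and y :: "(real ^ 'n) ^ 'N"

  obtain cd where cd: "cd > 0" "\<And>i t. t \<ge> T0 \<Longrightarrow> \<exists>xd. minimizer (f i t) xd \<and> norm xd \<le> cd"
    using B3 by blast
  obtain cT where cT: "\<And>T. T > T0 \<Longrightarrow> norm (xt T) \<le> cT" using B2_bounded by blast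
  \<comment> \<open>One radius for everything: it covers the minimizers of the local costs and all
    comparators, and being at least 1 it allows the gradient estimate to be tested on the unit
    ball.\<close>
  define R where "R = max 1 (max cd cT)"
  have R: "R \<ge> 1" "R \<ge> cd" "R \<ge> cT" unfolding R_def by auto
  then have "R > 0" by simp
  then obtain M where M: "M > 0" "\<And>y t i. norm y \<le> R \<Longrightarrow> t \<ge> T0 \<Longrightarrow> \<bar>f i t y\<bar> \<le> M"
    using B4 by blast
  have lower: "f i t y \<ge> - M" if t: "t \<ge> T0" for i t y
  proof -
    obtain xd where xd: "minimizer (f i t) xd" "norm xd \<le> cd" using cd(2)[OF t] by blast
    have "\<bar>f i t xd\<bar> \<le> M" using xd(2) R(2) t by (intro M(2)) auto
    then show ?thesis using minimizerD[OF xd(1), of y] by linarith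
  qed
  have outward: "r * norm (gradient (f i t) y) \<le> y \<bullet> gradient (f i t) y + M' + M"
    if "t \<ge> T0" "r \<ge> 0" "\<And>z. norm z \<le> r \<Longrightarrow> f i t z \<le> M'" for i t y r M'
    by (rule convex_gradient_outward[OF f_convex[OF that(1)] grad[OF that(1)] that(2,3) lower[OF that(1)]])
  \<comment> \<open>Each of the \<open>N\<close> costs can drop by at most \<open>2 * M\<close>
    below its value at a point of norm at most \<open>R\<close>.\<close>
  define \<rho>0 where "\<rho>0 = 2 * ?N * M"
  have \<rho>0: "\<rho>0 > 0" unfolding \<rho>0_def using M(1) by simp
  have diff_lower: "(\<Sum>i\<in>UNIV. f i t (y i)) - (\<Sum>i\<in>UNIV. f i t c) \<ge> - \<rho>0" if "t \<ge> T0" "norm c \<le> R" for t y c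
  proof -
    have "(\<Sum>i\<in>UNIV. f i t c - f i t (y i)) \<le> (\<Sum>i\<in>(UNIV::'N set). 2 * M)"
    proof (rule sum_mono)
      fix i show "f i t c - f i t (y i) \<le> 2 * M"
        using M(2)[OF that(2,1), of i] lower[OF that(1), of i "y i"] by linarith
    qed
    then show ?thesis by (simp add: sum_subtractf \<rho>0_def)
  qed

  obtain C where C: "\<And>t y. t \<ge> T0 \<Longrightarrow>
      \<bar>vector_derivative (\<lambda>s. stacked_cost f s y) (at t within {T0..})\<bar> \<le> C" using B5 by blast
  \<comment> \<open>The chain rule along a constant curve identifies \<open>d\<Phi>\<close> with the
    time derivative that (B5) bounds.\<close>
  have d\<Phi>: "\<bar>d\<Phi> t y\<bar> \<le> C" if t: "t \<ge> T0" for t y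
  proof -
    have "((\<lambda>s. f i s (y $ i)) has_vector_derivative d i t (y $ i)) (at t within {T0..})" for i
      using f_chain[OF t, of "\<lambda>_. y $ i" 0 i] by (simp add: has_real_derivative_iff_has_vector_derivative)
    then have "((\<lambda>s. stacked_cost f s (stack (($) y))) has_vector_derivative d\<Phi> t y) (at t within {T0..})"
      unfolding stacked_cost_def block_stack d\<Phi>_def by (intro has_vector_derivative_sum)
    then show ?thesis using C[OF t, of "stack (($) y)"]
      by (simp add: vector_derivative_within[OF at_within_atLeast_neq_bot[OF t]])
  qed

  \<comment> \<open>The trajectory as a damped flow in rescaled time\<close>
  have base: "t + b0 \<ge> 1" if "t \<ge> T0" for t using that T0 b0 by linarith
  have rate_pos: "?A t > 0" if "t \<ge> T0" for t using \<alpha>[OF that] exp_gt_zero[of "\<alpha> t"] by simp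
  have \<alpha>_deriv: "(\<alpha> has_real_derivative vector_derivative \<alpha> (at t within {T0..})) (at t within {T0..})" if t: "t \<ge> T0" for t
  proof (rule has_derivative_of_exp_eq[OF t \<alpha>])
    have p: "((\<lambda>s. (s + b0) powr r) has_real_derivative r * (t + b0) powr (r - 1)) (at t within {T0..})" for r
      using base[OF t] by (auto intro!: derivative_eq_intros)
    show "(?A has_real_derivative m * (- 1 * (t + b0) powr (- 1 - 1)) + \<sigma> * (- m * (t + b0) powr (- m - 1))) (at t within {T0..})"
      by (intro DERIV_add DERIV_cmult p)
  qed
  have X: "(X has_vector_derivative ?A t *\<^sub>R Q t) (at t within {T0..})" if t: "t \<ge> T0" for t
  proof -
    have "?A t *\<^sub>R Q t = (\<chi> i. v i t)"
      unfolding \<alpha>[OF t, symmetric] Q_def by (simp add: vec_eq_iff exp_minus)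
    then show ?thesis unfolding X_def[abs_def] using has_vector_derivative_vec_lambda[OF vel[OF t]] by simp
  qed
  have Q: "(Q has_vector_derivative ?A t *\<^sub>R
      (- 2 *\<^sub>R Q t - k1 *\<^sub>R lap_op A (X t) - (t + b0) powr m *\<^sub>R G t (X t))) (at t within {T0..})"
    if t: "t \<ge> T0" for t
  proof -
    let ?D = "vector_derivative \<alpha> (at t within {T0..})"
    have e: "((\<lambda>s. exp (- \<alpha> s)) has_real_derivative - exp (- \<alpha> t) * ?D) (at t within {T0..})"
      by (rule derivative_eq_intros \<alpha>_deriv[OF t] refl | simp)+
    have "((\<lambda>s. exp (- \<alpha> s) *\<^sub>R v i s) has_vector_derivative
       exp (- \<alpha> t) *\<^sub>R acc i t + (- exp (- \<alpha> t) * ?D) *\<^sub>R v i t) (at t within {T0..})" for i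
      by (rule has_vector_derivative_scaleR[OF e acc[OF t]])
    then have Qd: "(Q has_vector_derivative (\<chi> i. exp (- \<alpha> t) *\<^sub>R acc i t + (- exp (- \<alpha> t) * ?D) *\<^sub>R v i t)) (at t within {T0..})"
      unfolding Q_def[abs_def] by (rule has_vector_derivative_vec_lambda)
    have comp: "exp (- \<alpha> t) *\<^sub>R acc i t + (- exp (- \<alpha> t) * ?D) *\<^sub>R v i t
      = (?A t *\<^sub>R (- 2 *\<^sub>R Q t - k1 *\<^sub>R lap_op A (X t) - (t + b0) powr m *\<^sub>R G t (X t))) $ i" for i
    proof -
      let ?g = "gradient (f i t) (x i t)" and ?l = "lap_op A (X t) $ i"
      have l: "(\<Sum>j\<in>UNIV. (A $ i $ j * k1 * exp (2 * \<alpha> t)) *\<^sub>R (x i t - x j t)) = (k1 * exp (2 * \<alpha> t)) *\<^sub>R ?l"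
        by (simp add: lap_op_def X_def scaleR_sum_right ac_simps)
      have ex: "exp (2 * \<alpha> t) = exp (\<alpha> t) * exp (\<alpha> t)" "exp (2 * \<alpha> t + \<beta> t) = exp (\<alpha> t) * exp (\<alpha> t) * exp (\<beta> t)"
        by (simp_all add: exp_add[symmetric])
      have "exp (- \<alpha> t) *\<^sub>R acc i t + (- exp (- \<alpha> t) * ?D) *\<^sub>R v i t
        = exp (\<alpha> t) *\<^sub>R (- 2 *\<^sub>R (exp (- \<alpha> t) *\<^sub>R v i t) - k1 *\<^sub>R ?l - exp (\<beta> t) *\<^sub>R ?g)"
        unfolding exp_minus inverse_eq_divide
        by (rule rescaled_acceleration[OF exp_gt_zero ode[OF t, of i, unfolded l, unfolded ex]])
      then show ?thesis
        unfolding \<alpha>[OF t, symmetric] \<beta>[OF t, symmetric] by (simp add: Q_def G_def X_def)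
    qed
    have "(\<chi> i. exp (- \<alpha> t) *\<^sub>R acc i t + (- exp (- \<alpha> t) * ?D) *\<^sub>R v i t)
      = ?A t *\<^sub>R (- 2 *\<^sub>R Q t - k1 *\<^sub>R lap_op A (X t) - (t + b0) powr m *\<^sub>R G t (X t))"
      by (rule vec_eq_iff[THEN iffD2], intro allI, simp only: vec_lambda_beta comp)
    then show ?thesis using Qd by (simp only:)
  qed

  \<comment> \<open>Consensus points of radius \<open>R\<close>: they contain 0 and every
    comparator. In the interpretation \<open>\<rho>0\<close> fills two places, as the bound on the
    cost gap and as the sum of the gradient offsets \<open>2 * M\<close> over all agents.\<close>
  define K :: "((real ^ 'n) ^ 'N) set" where "K = {\<chi> i. c |c. norm c \<le> R}"
  interpret damped_flow "lap_op A" center \<Phi> d\<Phi> G X Q K T0 b0 m \<sigma> k1 C \<rho>0 \<rho>0 \<Lambda>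
  proof (rule damped_flow.intro)
    show "\<Phi> t y + G t y \<bullet> (z - y) \<le> \<Phi> t z" if "t \<ge> T0" for t y z
    proof -
      have "(\<Sum>i\<in>UNIV. f i t (y $ i) + gradient (f i t) (y $ i) \<bullet> (z $ i - y $ i)) \<le> \<Phi> t z"
        unfolding \<Phi>_def by (intro sum_mono convex_on_above_gradient f_convex grad that)
      then show ?thesis by (simp add: \<Phi>_def G_def inner_vec_def[of _ "z - y"] sum.distrib)
    qed
    show "((\<lambda>s. \<Phi> s (z s)) has_real_derivative d\<Phi> t (z t) + G t (z t) \<bullet> z') (at t within {T0..})"
      if "t \<ge> T0" "(z has_vector_derivative z') (at t within {T0..})" for t z z'
    proof -
      have "((\<lambda>s. z s $ i) has_vector_derivative z' $ i) (at t within {T0..})" for i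
        using bounded_linear.has_vector_derivative[OF bounded_linear_vec_nth that(2)] .
      then have "((\<lambda>s. \<Phi> s (z s)) has_real_derivative
         (\<Sum>i\<in>UNIV. d i t (z t $ i) + gradient (f i t) (z t $ i) \<bullet> z' $ i)) (at t within {T0..})"
        unfolding \<Phi>_def by (intro DERIV_sum f_chain[where z = "\<lambda>s. z s $ _"] that(1))
      then show ?thesis by (simp add: d\<Phi>_def G_def inner_vec_def[of _ z'] sum.distrib)
    qed
    show "(0 :: (real ^ 'n) ^ 'N) \<in> K"
      unfolding K_def using \<open>R > 0\<close> by (auto intro!: exI[of _ 0] simp: vec_eq_iff)
    show "lap_op A c = 0" if "c \<in> K" for c
      using that by (auto simp: K_def lap_op_def vec_eq_iff)
    show "\<Phi> t c - \<rho>0 \<le> \<Phi> t y" if "c \<in> K" "t \<ge> T0" for c t y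
      using that diff_lower[OF that(2), of _ "($) y"] by (force simp: K_def \<Phi>_def)
    show "norm (G t y) \<le> y \<bullet> G t y + \<rho>0" if t: "t \<ge> T0" for t y
    proof -
      have "norm (G t y) \<le> (\<Sum>i\<in>UNIV. norm (gradient (f i t) (y $ i)))"
        using norm_vec_le_sum[of "G t y"] by (simp add: G_def)
      also have "\<dots> \<le> (\<Sum>i\<in>UNIV. y $ i \<bullet> gradient (f i t) (y $ i) + 2 * M)"
      proof (rule sum_mono)
        fix i
        have "1 * norm (gradient (f i t) (y $ i)) \<le> y $ i \<bullet> gradient (f i t) (y $ i) + M + M"
          using M(2) R t by (intro outward) (auto intro: order_trans[OF abs_ge_self])
        then show "norm (gradient (f i t) (y $ i)) \<le> y $ i \<bullet> gradient (f i t) (y $ i) + 2 * M" by simp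
      qed
      also have "\<dots> = y \<bullet> G t y + \<rho>0"
        by (simp add: sum.distrib inner_vec_def[of y] G_def \<rho>0_def)
      finally show ?thesis .
    qed
    show "linear (lap_op A)" "linear center" by (rule linear_lap_op linear_center)+
    show "y \<bullet> lap_op A z = lap_op A y \<bullet> z" for y z :: "(real ^ 'n) ^ 'N" by (rule lap_op_selfadjoint[OF sym])
    show "y \<bullet> center z = center y \<bullet> z" "center (center y) = center y" "lap_op A (center y) = lap_op A y"
      "center (lap_op A y) = lap_op A y" for y z :: "(real ^ 'n) ^ 'N"
      by (rule inner_center center_idem lap_op_center center_lap_op[OF sym])+
    show "T0 \<ge> 0" "b0 \<ge> 1" "m < - 1" "\<sigma> > 0" "k1 > 0" by fact+
    show "?A t > 0" if "t \<ge> T0" for t using that by (rule rate_pos)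
    show "\<Lambda> > 0" by (fact \<Lambda>(1))
    show "(norm (center y))\<^sup>2 \<le> \<Lambda> * (y \<bullet> lap_op A y)" "y \<bullet> lap_op A y \<ge> 0" for y :: "(real ^ 'n) ^ 'N"
      by (fact \<Lambda>)+
    show "\<bar>d\<Phi> t y\<bar> \<le> C" if "t \<ge> T0" for t y using that by (rule d\<Phi>)
    show "(X has_vector_derivative ?A t *\<^sub>R Q t) (at t within {T0..})" if "t \<ge> T0" for t
      using that by (rule X)
    show "(Q has_vector_derivative ?A t *\<^sub>R
      (- 2 *\<^sub>R Q t - k1 *\<^sub>R lap_op A (X t) - (t + b0) powr m *\<^sub>R G t (X t))) (at t within {T0..})"
      if "t \<ge> T0" for t using that by (rule Q)
  qed
  have a_exp: "a t = exp (\<alpha> t)" if "t \<ge> T0" for t using \<alpha>[OF that] by (simp add: a_def)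
  have norm_K: "norm c \<le> ?N * R" if cK: "c \<in> K" for c
  proof -
    obtain c' where c': "c = (\<chi> i. c')" "norm c' \<le> R" using cK by (auto simp: K_def)
    have "norm c \<le> ?N * norm c'" using norm_vec_le_sum[of c] by (simp add: c'(1))
    also have "\<dots> \<le> ?N * R" using c'(2) by (intro mult_left_mono) auto
    finally show ?thesis .
  qed
  obtain W where W: "\<And>c. c \<in> K \<Longrightarrow> V c T0 \<le> W"
    by (rule V_initial_bounded[OF norm_K]) auto
  have V0: "V 0 T0 \<ge> 0" using V_nonneg(2)[OF _ K(1)] by simp
  then have W0: "W \<ge> 0" using W[OF K(1)] by linarith

  define a1 where "a1 = sqrt (2 * \<sigma> * \<rho>0)"
  \<comment> \<open>The added 1 ensures positivity, since \<open>V 0 T0\<close> is only known to be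
    nonnegative.\<close>
  define b1 where "b1 = sqrt (2 * V 0 T0) + 1"
  have a1: "a1 > 0" unfolding a1_def using \<sigma> \<rho>0 by simp
  have b1: "b1 > 0" unfolding b1_def using V0 by (simp add: add_nonneg_pos)
  have state_bound: "norm (x j t) \<le> a1 * sqrt t + b1" if t: "t \<ge> T0" for j t
  proof -
    have "norm (x j t) \<le> norm (X t)" using Finite_Cartesian_Product.norm_nth_le[of "X t" j] by (simp add: X_def)
    also have "\<dots> \<le> sqrt (2 * \<sigma> * \<rho>0 * t + 2 * V 0 T0)"
    proof (rule real_le_rsqrt)
      have "\<sigma> * \<rho>0 * T0 \<ge> 0" using \<sigma> \<rho>0 T0 by simp
      then show "(norm (X t))\<^sup>2 \<le> 2 * \<sigma> * \<rho>0 * t + 2 * V 0 T0"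
        using growth[OF t] by (simp add: algebra_simps)
    qed
    also have "\<dots> \<le> sqrt (2 * \<sigma> * \<rho>0 * t) + sqrt (2 * V 0 T0)"
      using V0 \<sigma> \<rho>0 t T0 by (intro sqrt_add_le_add_sqrt) auto
    finally show ?thesis by (simp add: a1_def b1_def real_sqrt_mult)
  qed
  obtain a2 b2 where ab2: "a2 > 0" "b2 > 0" and gg: "gradient_growth f T0 m0 a1 b1 a2 b2"
    using B6 a1 b1 by blast
  \<comment> \<open>(B6) concerns arbitrary curves, so it covers the gradient of every cost along
    every agent; the regret needs the mixed pairs.\<close>
  have grad_x: "norm (gradient (f i t) (x j t)) \<le> a2 * t powr m0 + b2" if "t > T0" for i j t
    using gg state_bound that unfolding gradient_growth_def by (meson less_imp_le)
  \<comment> \<open>A bound valid from \<open>T0\<close> on. Up to \<open>T0 + 1\<close> the states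
    stay in a ball and (B4) bounds the gradients, which avoids \<open>t powr m0\<close> near zero;
    later \<open>t \<ge> 1\<close>, and \<open>m \<le> - 2 * m0\<close> compares the powers.\<close>
  obtain g0 where g0: "g0 \<ge> 0" "\<And>i j t. t \<ge> T0 \<Longrightarrow> norm (gradient (f i t) (x j t)) \<le> g0 * (t + b0) powr (- m / 2)"
  proof -
    define r where "r = a1 * sqrt (T0 + 1) + b1"
    have r: "r > 0" unfolding r_def using a1 b1 T0 by (intro add_nonneg_pos) auto
    then have "r + 1 > 0" by simp
    then obtain M1 where M1: "M1 > 0" "\<And>y t i. norm y \<le> r + 1 \<Longrightarrow> t \<ge> T0 \<Longrightarrow> \<bar>f i t y\<bar> \<le> M1"
      using B4 by blast
    have one: "1 \<le> (t + b0) powr (- m / 2)" if "t \<ge> T0" for t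
      using base[OF that] m by (intro ge_one_powr_ge_zero) auto
    have "norm (gradient (f i t) (x j t)) \<le> (a2 + b2 + M1 + M) * (t + b0) powr (- m / 2)" if t: "t \<ge> T0" for i j t
    proof (cases "t \<le> T0 + 1")
      case True
      let ?g = "gradient (f i t) (x j t)"
      have "a1 * sqrt t \<le> a1 * sqrt (T0 + 1)" using True a1 by (intro mult_left_mono) auto
      then have "norm (x j t) \<le> r" using state_bound[OF t, of j] unfolding r_def by linarith
      then have "x j t \<bullet> ?g \<le> r * norm ?g"
        using norm_cauchy_schwarz[of "x j t" ?g] mult_right_mono[of "norm (x j t)" r "norm ?g"] by simp
      \<comment> \<open>Testing at radius \<open>r + 1\<close> while the state has norm at most
        \<open>r\<close> leaves exactly one copy of the gradient norm.\<close>
      moreover have "(r + 1) * norm ?g \<le> x j t \<bullet> ?g + M1 + M"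
        using M1(2) r t by (intro outward) (auto intro: order_trans[OF abs_ge_self])
      ultimately have "norm ?g \<le> M1 + M" by (simp add: algebra_simps)
      also have "\<dots> \<le> a2 + b2 + M1 + M" using ab2 by simp
      also have "\<dots> * 1 \<le> \<dots> * (t + b0) powr (- m / 2)"
        using ab2 M1(1) M(1) one[OF t] by (intro mult_left_mono) auto
      finally show ?thesis by simp
    next
      case False
      then have t': "t > T0" "t \<ge> 1" using T0 by auto
      have "t powr m0 \<le> t powr (- m / 2)" using t' m by (intro powr_mono) auto
      also have "\<dots> \<le> (t + b0) powr (- m / 2)" using t' m b0 by (intro powr_mono2) auto
      finally have "a2 * t powr m0 \<le> a2 * (t + b0) powr (- m / 2)" using ab2 by (intro mult_left_mono) auto
      moreover have "b2 * 1 \<le> b2 * (t + b0) powr (- m / 2)" using ab2 one[OF t] by (intro mult_left_mono) auto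
      moreover have "(M1 + M) * (t + b0) powr (- m / 2) \<ge> 0" using M1(1) M(1) by simp
      ultimately show ?thesis using grad_x[OF t'(1), of i j] by (simp add: algebra_simps)
    qed
    moreover have "a2 + b2 + M1 + M \<ge> 0" using ab2 M1(1) M(1) by simp
    ultimately show ?thesis using that by blast
  qed

  define c0 where "c0 = a T0 * b T0"
  have c0: "c0 > 0" unfolding c0_def using ab_bounds(1)[of T0] by simp
  \<comment> \<open>The factor \<open>N\<close> is included so that summing \<open>c1 / N\<close>
    over all pairs and averaging over the agents yields \<open>c1\<close>.\<close>
  define c1 where "c1 = 2 * ?N * g0 / c0"
  have c1: "c1 \<ge> 0" unfolding c1_def using g0 c0 by simp
  have cross: "f i t (x j t) - f i t (x i t) \<le> c1 / ?N * (\<phi> t * a t * norm (center (X t)))" if t: "t \<ge> T0" for i j t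
  proof -
    let ?g = "gradient (f i t) (x j t)" and ?w = "(t + b0) powr (- m / 2)" and ?P = "norm (center (X t))"
    have "f i t (x j t) + ?g \<bullet> (x i t - x j t) \<le> f i t (x i t)"
      by (rule convex_on_above_gradient[OF f_convex[OF t] grad[OF t]])
    then have "f i t (x j t) - f i t (x i t) \<le> ?g \<bullet> (x j t - x i t)"
      by (simp add: inner_diff_right)
    also have "\<dots> \<le> norm ?g * norm (x j t - x i t)" by (rule norm_cauchy_schwarz)
    also have "\<dots> \<le> (g0 * ?w) * (2 * ?P)"
    proof (rule mult_mono)
      have "x j t - x i t = center (X t) $ j - center (X t) $ i" by (simp add: center_def X_def)
      also have "norm \<dots> \<le> 2 * ?P"
        using norm_triangle_ineq4[of "center (X t) $ j" "center (X t) $ i"]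
          Finite_Cartesian_Product.norm_nth_le[of "center (X t)" j]
          Finite_Cartesian_Product.norm_nth_le[of "center (X t)" i] by linarith
      finally show "norm (x j t - x i t) \<le> 2 * ?P" .
    qed (use g0 t in auto)
    also have "\<dots> = 2 * g0 / c0 * ((c0 * ?w) * ?P)" using c0 by simp
    also have "\<dots> \<le> 2 * g0 / c0 * ((\<phi> t * a t) * ?P)"
      using weight_le_\<phi>_a[OF t] g0 c0 unfolding c0_def by (intro mult_left_mono mult_right_mono) auto
    also have "\<dots> = c1 / ?N * (\<phi> t * a t * ?P)" by (simp add: c1_def)
    finally show ?thesis .
  qed

  \<comment> \<open>Choice of the final constants and the regret bound\<close>
  define k0 where "k0 = c1 * (4 / \<kappa> * (\<phi> T0 * (V 0 T0 + U T0)))"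
  define k2 where "k2 = c1 * (4 / \<kappa> * (\<kappa> * \<sigma> + 2 * \<sigma> * \<rho>0))"
  have k0: "k0 \<ge> 0" unfolding k0_def using c1 \<kappa>_pos V0 U_bounds(1)[of T0] by (simp add: \<phi>_def)
  have k2: "k2 \<ge> 0" unfolding k2_def using c1 \<kappa>_pos \<sigma> \<rho>0 by simp
  define S where "S T = integral {T0..T} (\<lambda>t. a t * (X t \<bullet> lap_op A (X t)))" for T
  have S: "S T \<ge> 0" for T unfolding S_def by (rule dissipation_integral_nonneg)

  \<comment> \<open>With the second summand alone, the \<open>\<epsilon>1\<close> term of the bound
    equals \<open>k2 * sqrt (T - T0)\<close>. There is no circularity, as \<open>a2\<close> and
    \<open>k2\<close> are fixed before \<open>\<rho>\<close>.\<close>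
  define \<rho> where "\<rho> = \<rho>0 + w_min * k1 / ?N * (k2 / (?N * a2))\<^sup>2"
  \<comment> \<open>After division by \<open>\<sigma>\<close>, \<open>W\<close> pays for the initial
    Lyapunov value and \<open>\<sigma> * k0\<close> for the constant part of the disagreement; the 1
    ensures positivity.\<close>
  define \<omega> where "\<omega> = W + \<sigma> * k0 + 1"
  have w: "w_min > 0" using w_min by (simp add: minimal_edge_weight_def)
  have \<rho>: "\<rho> \<ge> \<rho>0" unfolding \<rho>_def using w k1 by simp
  then have \<rho>_pos: "\<rho> > 0" using \<rho>0 by linarith
  have \<omega>: "\<omega> > 0" "\<omega> \<ge> W" unfolding \<omega>_def using W0 k0 \<sigma> by (simp_all add: add_nonneg_pos)

  have conclusion: "(\<forall>y. \<forall>t\<in>{T0..T}. stacked_cost f t y - stacked_cost f t (kron_vec 1 (xt T)) \<ge> - \<rho>)"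
    "integral {T0..T}
      (\<lambda>t. exp (\<alpha> t) * (stack (\<lambda>i. x i t) \<bullet> (kron (laplacian A) (mat 1) *v stack (\<lambda>i. x i t)))
            - \<sigma> * \<rho> / k1) \<le> \<omega> / k1"
    "static_regret f T0 x xt T \<le> \<omega> / \<sigma>
        + ?N * a2 / sqrt \<sigma> * sqrt (?N / w_min * (\<sigma> * \<rho> / k1 * (T - T0) + \<omega> / k1))
        + ?N * b2 * sqrt (?N / w_min * (\<rho> / (k1 * b0 powr (- m)) * (T - T0) + \<omega> / (k1 * \<sigma> * b0 powr (- m))))"
    if T: "T > T0" for T
  proof -
    define c :: "(real ^ 'n) ^ 'N" where "c = (\<chi> i. xt T)"
    have xtR: "norm (xt T) \<le> R" using cT[OF T] R by linarith
    then have c: "c \<in> K" by (auto simp: K_def c_def)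
    have kron: "stacked_cost f t (kron_vec 1 (xt T)) = \<Phi> t c" for t
      by (simp add: stacked_cost_def block_kron_vec_1 \<Phi>_def c_def)
    show "\<forall>y. \<forall>t\<in>{T0..T}. stacked_cost f t y - stacked_cost f t (kron_vec 1 (xt T)) \<ge> - \<rho>"
    proof (intro allI ballI)
      fix y t assume "t \<in> {T0..T}"
      then have "- \<rho>0 \<le> stacked_cost f t y - stacked_cost f t (kron_vec 1 (xt T))"
        using diff_lower[of t "xt T" "block y"] xtR by (simp add: stacked_cost_def block_kron_vec_1)
      then show "stacked_cost f t y - stacked_cost f t (kron_vec 1 (xt T)) \<ge> - \<rho>" using \<rho> by linarith
    qed
    let ?I = "integral {T0..T} (\<lambda>t. \<Phi> t (X t) - \<Phi> t c)"
    have sub: "{T0..T} \<subseteq> {T0..}" by auto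
    have int_\<Phi>: "(\<lambda>t. \<Phi> t (X t) - \<Phi> t c) integrable_on {T0..T}"
      by (intro integrable_continuous_real continuous_on_diff continuous_on_subset[OF continuous_\<Phi>(1) sub]
          continuous_on_subset[OF continuous_\<Phi>(2) sub])
    have int_S: "(\<lambda>t. a t * (X t \<bullet> lap_op A (X t))) integrable_on {T0..T}"
      by (intro integrable_continuous_real continuous_on_mult continuous_on_inner
          continuous_on_subset[OF continuous_a sub] continuous_on_subset[OF continuous_X sub]
          continuous_on_subset[OF continuous_LX sub])
    have val: "\<sigma> * ?I + k1 * S T \<le> W"
      using value_bound[OF less_imp_le[OF T] c] W[OF c] unfolding S_def by linarith
    \<comment> \<open>Since the cost gap cannot be very negative, \<open>val\<close> also bounds the
      dissipation \<open>S T\<close>, linearly in the horizon.\<close>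
    have I_lower: "?I \<ge> - \<rho>0 * (T - T0)"
    proof -
      have "integral {T0..T} (\<lambda>t. - \<rho>0) \<le> ?I"
        using int_\<Phi> K(3)[OF c] by (intro integral_le) (auto simp: algebra_simps)
      then show ?thesis using T by (simp add: mult.commute)
    qed
    show "integral {T0..T}
      (\<lambda>t. exp (\<alpha> t) * (stack (\<lambda>i. x i t) \<bullet> (kron (laplacian A) (mat 1) *v stack (\<lambda>i. x i t)))
            - \<sigma> * \<rho> / k1) \<le> \<omega> / k1"
    proof -
      have "integral {T0..T}
        (\<lambda>t. exp (\<alpha> t) * (stack (\<lambda>i. x i t) \<bullet> (kron (laplacian A) (mat 1) *v stack (\<lambda>i. x i t)))
            - \<sigma> * \<rho> / k1) = integral {T0..T} (\<lambda>t. a t * (X t \<bullet> lap_op A (X t)) - \<sigma> * \<rho> / k1)"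
        by (intro integral_cong) (simp add: a_exp inner_stack_kron_laplacian X_def)
      also have "\<dots> = S T - \<sigma> * \<rho> / k1 * (T - T0)"
        using T int_S by (subst integral_diff) (auto simp: S_def)
      also have "\<dots> \<le> \<omega> / k1"
      proof -
        have "\<sigma> * (\<rho>0 * (T - T0)) \<le> \<sigma> * (\<rho> * (T - T0))"
          using \<rho> \<sigma> T by (intro mult_left_mono mult_right_mono) auto
        moreover have "\<sigma> * ?I \<ge> \<sigma> * (- \<rho>0 * (T - T0))" using I_lower \<sigma> by (intro mult_left_mono) auto
        ultimately have "k1 * S T - \<sigma> * (\<rho> * (T - T0)) \<le> \<omega>" using val \<omega>(2) by simp
        then have "(k1 * S T - \<sigma> * (\<rho> * (T - T0))) / k1 \<le> \<omega> / k1" using k1 by (intro divide_right_mono) auto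
        moreover have "(k1 * S T - \<sigma> * (\<rho> * (T - T0))) / k1 = S T - \<sigma> * \<rho> / k1 * (T - T0)"
          using k1 by (simp add: diff_divide_distrib)
        ultimately show ?thesis by simp
      qed
      finally show ?thesis .
    qed
    let ?h = "\<lambda>t. \<phi> t * a t * norm (center (X t))"
    have "static_regret f T0 x xt T \<le> integral {T0..T} (\<lambda>t. (\<Phi> t (X t) - \<Phi> t c) + c1 * ?h t)"
      unfolding static_regret_def kron
    proof (rule integral_le)
      have "continuous_on {T0..} (\<lambda>t. f i t (x j t))" for i j
        using f_chain[OF _ vel] by (intro DERIV_continuous_on) auto
      then have "continuous_on {T0..T} (\<lambda>t. f i t (x j t))" for i j
        using sub continuous_on_subset by blast
      then show "(\<lambda>t. 1 / ?N * (\<Sum>j\<in>UNIV. \<Sum>i\<in>UNIV. f i t (x j t)) - \<Phi> t c) integrable_on {T0..T}"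
        by (intro integrable_continuous_real continuous_on_diff continuous_on_mult continuous_on_const
            continuous_on_sum continuous_on_subset[OF continuous_\<Phi>(2) sub])
      show "(\<lambda>t. (\<Phi> t (X t) - \<Phi> t c) + c1 * ?h t) integrable_on {T0..T}"
        using int_\<Phi> disagreement_bound(1)[OF less_imp_le[OF T]] by (intro integrable_add integrable_on_mult_right)
      fix t assume "t \<in> {T0..T}"
      then have t: "t \<ge> T0" by simp
      have "(\<Sum>j\<in>UNIV. \<Sum>i\<in>UNIV. f i t (x j t)) - ?N * \<Phi> t (X t)
        = (\<Sum>j\<in>UNIV. \<Sum>i\<in>UNIV. f i t (x j t) - f i t (x i t))"
        by (simp add: \<Phi>_def X_def sum_subtractf)
      also have "\<dots> \<le> (\<Sum>j\<in>(UNIV :: 'N set). \<Sum>i\<in>(UNIV :: 'N set). c1 / ?N * ?h t)"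
        by (intro sum_mono cross[OF t])
      also have "\<dots> = ?N * (c1 * ?h t)" by simp
      finally have "(\<Sum>j\<in>UNIV. \<Sum>i\<in>UNIV. f i t (x j t)) \<le> ?N * (\<Phi> t (X t) + c1 * ?h t)"
        by (simp add: algebra_simps)
      then have "1 / ?N * (\<Sum>j\<in>UNIV. \<Sum>i\<in>UNIV. f i t (x j t)) \<le> \<Phi> t (X t) + c1 * ?h t"
        by (simp add: field_simps)
      then show "1 / ?N * (\<Sum>j\<in>UNIV. \<Sum>i\<in>UNIV. f i t (x j t)) - \<Phi> t c \<le> (\<Phi> t (X t) - \<Phi> t c) + c1 * ?h t"
        by simp
    qed
    also have "\<dots> = ?I + c1 * integral {T0..T} ?h"
      using int_\<Phi> disagreement_bound(1)[OF less_imp_le[OF T]] by (subst integral_add) (auto intro: integrable_on_mult_right)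
    also have "c1 * integral {T0..T} ?h \<le> k0 + k2 * sqrt (T - T0)"
      using mult_left_mono[OF disagreement_bound(2)[OF less_imp_le[OF T]] c1]
      unfolding k0_def k2_def by (simp add: algebra_simps)
    also have "?I \<le> W / \<sigma>"
    proof -
      have "k1 * S T \<ge> 0" using k1 S by simp
      then have "\<sigma> * ?I \<le> W" using val by linarith
      then show ?thesis using \<sigma> by (simp add: field_simps)
    qed
    finally have regret: "static_regret f T0 x xt T \<le> W / \<sigma> + (k0 + k2 * sqrt (T - T0))" by simp
    have "W / \<sigma> + k0 \<le> \<omega> / \<sigma>" unfolding \<omega>_def using \<sigma> by (simp add: field_simps)
    moreover have "k2 * sqrt (T - T0) \<le> ?N * a2 / sqrt \<sigma> * sqrt (?N / w_min * (\<sigma> * \<rho> / k1 * (T - T0) + \<omega> / k1))"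
    proof -
      have N: "?N > 0" by simp
      have "\<sigma> * (k2 / (?N * a2))\<^sup>2 * (T - T0) = ?N / w_min * (\<sigma> * (w_min * k1 / ?N * (k2 / (?N * a2))\<^sup>2) / k1 * (T - T0))"
        using w k1 N by simp
      also have "\<dots> \<le> ?N / w_min * (\<sigma> * \<rho> / k1 * (T - T0) + \<omega> / k1)"
      proof (rule mult_left_mono)
        have "\<sigma> * (w_min * k1 / ?N * (k2 / (?N * a2))\<^sup>2) / k1 * (T - T0) \<le> \<sigma> * \<rho> / k1 * (T - T0)"
          using \<rho>0 \<sigma> k1 T unfolding \<rho>_def by (intro mult_right_mono divide_right_mono mult_left_mono) auto
        moreover have "\<omega> / k1 \<ge> 0" using \<omega>(1) k1 by simp
        ultimately show "\<sigma> * (w_min * k1 / ?N * (k2 / (?N * a2))\<^sup>2) / k1 * (T - T0)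
          \<le> \<sigma> * \<rho> / k1 * (T - T0) + \<omega> / k1" by linarith
      qed (use w in simp)
      finally have "sqrt (\<sigma> * (k2 / (?N * a2))\<^sup>2 * (T - T0)) \<le> sqrt (?N / w_min * (\<sigma> * \<rho> / k1 * (T - T0) + \<omega> / k1))"
        by (rule real_sqrt_le_mono)
      then have "?N * a2 / sqrt \<sigma> * sqrt (\<sigma> * (k2 / (?N * a2))\<^sup>2 * (T - T0))
        \<le> ?N * a2 / sqrt \<sigma> * sqrt (?N / w_min * (\<sigma> * \<rho> / k1 * (T - T0) + \<omega> / k1))"
        using ab2 \<sigma> by (intro mult_left_mono) auto
      moreover have "?N * a2 / sqrt \<sigma> * sqrt (\<sigma> * (k2 / (?N * a2))\<^sup>2 * (T - T0)) = k2 * sqrt (T - T0)"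
        using k2 ab2 \<sigma> N by (simp add: real_sqrt_mult)
      ultimately show ?thesis by simp
    qed
    \<comment> \<open>The disagreement is already absorbed by the preceding term, so nonnegativity
      suffices here.\<close>
    moreover have "?N * b2 * sqrt (?N / w_min * (\<rho> / (k1 * b0 powr (- m)) * (T - T0) + \<omega> / (k1 * \<sigma> * b0 powr (- m)))) \<ge> 0"
      using ab2 w k1 \<sigma> \<rho>_pos \<omega> T by (intro mult_nonneg_nonneg real_sqrt_ge_zero add_nonneg_nonneg) auto
    ultimately show "static_regret f T0 x xt T \<le> \<omega> / \<sigma>
        + ?N * a2 / sqrt \<sigma> * sqrt (?N / w_min * (\<sigma> * \<rho> / k1 * (T - T0) + \<omega> / k1))
        + ?N * b2 * sqrt (?N / w_min * (\<rho> / (k1 * b0 powr (- m)) * (T - T0) + \<omega> / (k1 * \<sigma> * b0 powr (- m))))"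
      using regret by linarith
  qed
  have growth_ex: "\<exists>a1>0. \<exists>b1>0. gradient_growth f T0 m0 a1 b1 a2 b2" using a1 b1 gg by blast
  show ?thesis
    unfolding Let_def
    by (rule exI[of _ \<rho>], rule conjI[OF \<rho>_pos], rule exI[of _ \<omega>], rule conjI[OF \<omega>(1)],
        rule exI[of _ a2], rule conjI[OF ab2(1)], rule exI[of _ b2], rule conjI[OF ab2(2)],
        rule conjI[OF growth_ex], rule conjI, intro allI impI, erule grad_x,
        intro allI impI, rule conjI, erule conclusion(1), rule conjI, erule conclusion(2), erule conclusion(3))
qed

end
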